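(* Let $m_{00},m_{11},m_{22},m_{33}\ge0$ with $\sum_im_{ii}=1$ and error rates $e_x,e_y$ be the values obtained in parameter estimation in the six-state protocol, let $e_z=e_b=m_{11}+m_{22}$, and let $\mathcal{S}$ be the (nonempty) set of all two-qubit states $\rho_{AB}$ whose diagonal elements in the ordered basis $|00\rangle,|01\rangle,|10\rangle,|11\rangle$ are $m_{00},m_{11},m_{22},m_{33}$ and which satisfy $\mathrm{Tr}(\Pi_x^-\rho_{AB})=e_x$ and $\mathrm{Tr}(\Pi_y^-\rho_{AB})=e_y$. Let $$\tau=\begin{pmatrix}m_{00}&0&0&(1-e_x-e_y)/2\\0&m_{11}&(e_y-e_x)/2&0\\0&(e_y-e_x)/2&m_{22}&0\\(1-e_x-e_y)/2&0&0&m_{33}\end{pmatrix}.$$ Then, in the symmetric case, the secret key rate $K$ of the six-state QKD protocol satisfies $$K=\min_{\rho_{AB}\in\mathcal{S}}C(\Phi(\rho_{AB}))-H(e_b)=K_{six}^{opt},\qquad K_{six}^{opt}:=C(\tau)-H(e_z).$$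
   Context: States are density operators on $\mathbb{C}^2\otimes\mathbb{C}^2$; logarithms are base 2; $S(\rho)=-\mathrm{Tr}[\rho\log_2\rho]$; $H(e)=-e\log_2e-(1-e)\log_2(1-e)$. $|\pm\rangle=(|0\rangle\pm|1\rangle)/\sqrt2$, $|\pm i\rangle=(|0\rangle\pm i|1\rangle)/\sqrt2$. $\Pi^+=|00\rangle\langle00|+|11\rangle\langle11|$, $\Pi^-=|01\rangle\langle01|+|10\rangle\langle10|$, $\Pi_x^-=|{+-}\rangle\langle{+-}|+|{-+}\rangle\langle{-+}|$, $\Pi_y^-=|{+i},{+i}\rangle\langle{+i},{+i}|+|{-i},{-i}\rangle\langle{-i},{-i}|$. $\Phi(\rho)=\Pi^+\rho\,\Pi^++\Pi^-\rho\,\Pi^-$. $C(\rho)=S(\rho^{\mathrm{diag}})-S(\rho)$ is the relative entropy of coherence in the reference basis $\{|00\rangle,|01\rangle,|10\rangle,|11\rangle\}$, with $\rho^{\mathrm{diag}}$ the diagonal part of $\rho$ in that basis. Key rate. Alice and Bob share i.i.d. copies of an unknown $\rho_{AB}\in\mathcal{S}$ (collective attacks, asymptotic limit) and generate key by measuring in the $Z$ basis $\{|0\rangle,|1\rangle\}$. In the symmetric case the reconciliation cost is taken to be $H(e_b)$. For a state $\rho$ of $Q=AB$ with purification $|\psi\rangle_{QE}$, let $R(\rho)=S(Q|E)$ be the conditional entropy of the state $\sum_i|i\rangle\langle i|_Q\otimes\langle i|_Q|\psi\rangle\langle\psi|_{QE}|i\rangle_Q$ obtained by measuring $Q$ in the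 reference basis. With $\rho_{AB}^{\pm}=\Pi^{\pm}\rho_{AB}\Pi^{\pm}/\mathrm{Tr}(\Pi^{\pm}\rho_{AB})$ (terms of zero weight omitted) and $\sigma_x^B$ the bit flip on Bob's qubit, the key rate is $K=\min_{\rho_{AB}\in\mathcal{S}}\left[(1-e_b)R(\rho_{AB}^+)+e_bR(\sigma_x^B\rho_{AB}^-\sigma_x^B)\right]-H(e_b)$. *)

theory Defs
  imports Complex_Main "Jordan_Normal_Form.Schur_Decomposition"
begin

text \<open>Kets are column matrices. A tensor product is the Kronecker product, so the basis vector
  \<open>|a\<rangle> \<otimes> |b\<rangle>\<close> of an \<open>m\<close>-dimensional tensor an \<open>n\<close>-dimensional system has index \<open>a * n + b\<close>;
  for two qubits the indices \<open>0, 1, 2, 3\<close> are \<open>00, 01, 10, 11\<close>.\<close>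

definition mtrace :: "complex mat \<Rightarrow> complex" where
  "mtrace A = (\<Sum>i<dim_row A. A $$ (i, i))"

definition kron :: "complex mat \<Rightarrow> complex mat \<Rightarrow> complex mat" where
  "kron A B = mat (dim_row A * dim_row B) (dim_col A * dim_col B)
     (\<lambda>(r, c). A $$ (r div dim_row B, c div dim_col B) * B $$ (r mod dim_row B, c mod dim_col B))"

definition ket :: "nat \<Rightarrow> nat \<Rightarrow> complex mat" where
  "ket n i = mat n 1 (\<lambda>(r, c). if r = i then 1 else 0)"

definition outer :: "complex mat \<Rightarrow> complex mat" where
  "outer v = v * mat_adjoint v"

definition ket_plus :: "complex mat" where
  "ket_plus = complex_of_real (1 / sqrt 2) \<cdot>\<^sub>m (ket 2 0 + ket 2 1)"

definition ket_minus :: "complex mat" where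
  "ket_minus = complex_of_real (1 / sqrt 2) \<cdot>\<^sub>m (ket 2 0 - ket 2 1)"

definition ket_plus_i :: "complex mat" where
  "ket_plus_i = complex_of_real (1 / sqrt 2) \<cdot>\<^sub>m (ket 2 0 + \<i> \<cdot>\<^sub>m ket 2 1)"

definition ket_minus_i :: "complex mat" where
  "ket_minus_i = complex_of_real (1 / sqrt 2) \<cdot>\<^sub>m (ket 2 0 - \<i> \<cdot>\<^sub>m ket 2 1)"

definition Pi_plus :: "complex mat" where
  "Pi_plus = outer (kron (ket 2 0) (ket 2 0)) + outer (kron (ket 2 1) (ket 2 1))"

definition Pi_minus :: "complex mat" where
  "Pi_minus = outer (kron (ket 2 0) (ket 2 1)) + outer (kron (ket 2 1) (ket 2 0))"

definition Pi_x_minus :: "complex mat" where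
  "Pi_x_minus = outer (kron ket_plus ket_minus) + outer (kron ket_minus ket_plus)"

definition Pi_y_minus :: "complex mat" where
  "Pi_y_minus = outer (kron ket_plus_i ket_plus_i) + outer (kron ket_minus_i ket_minus_i)"

definition sigma_x_B :: "complex mat" where
  "sigma_x_B = kron (1\<^sub>m 2) (mat 2 2 (\<lambda>(i, j). if i = j then 0 else 1))"

definition Phi :: "complex mat \<Rightarrow> complex mat" where
  "Phi \<rho> = Pi_plus * \<rho> * Pi_plus + Pi_minus * \<rho> * Pi_minus"

definition density_operator :: "nat \<Rightarrow> complex mat \<Rightarrow> bool" where
  "density_operator n \<rho> \<longleftrightarrow>
     \<rho> \<in> carrier_mat n n \<and> mat_adjoint \<rho> = \<rho> \<and>
     (\<forall>v \<in> carrier_vec n. 0 \<le> Re ((\<rho> *\<^sub>v v) \<bullet>c v)) \<and> mtrace \<rho> = 1"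

text \<open>Functional calculus for Hermitian matrices. The result does not depend on the spectral
  decomposition, which is why a definite description is used.\<close>

definition hermitian_fun :: "(real \<Rightarrow> real) \<Rightarrow> complex mat \<Rightarrow> complex mat" where
  "hermitian_fun f A = (THE B. \<exists>U d. let n = dim_row A in
     U \<in> carrier_mat n n \<and> mat_adjoint U * U = 1\<^sub>m n \<and>
     A = U * mat_diag n (\<lambda>i. complex_of_real (d i)) * mat_adjoint U \<and>
     B = U * mat_diag n (\<lambda>i. complex_of_real (f (d i))) * mat_adjoint U)"

text \<open>Since \<open>log 2 0 = 0\<close> here, both definitions below implement the convention
  \<open>0 * log 2 0 = 0\<close>.\<close>

definition entropy :: "complex mat \<Rightarrow> real" where
  "entropy \<rho> = - Re (mtrace (\<rho> * hermitian_fun (log 2) \<rho>))"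

definition binary_entropy :: "real \<Rightarrow> real" where
  "binary_entropy e = - e * log 2 e - (1 - e) * log 2 (1 - e)"

definition diag_part :: "complex mat \<Rightarrow> complex mat" where
  "diag_part \<rho> = mat_diag (dim_row \<rho>) (\<lambda>i. \<rho> $$ (i, i))"

definition coherence :: "complex mat \<Rightarrow> real" where
  "coherence \<rho> = entropy (diag_part \<rho>) - entropy \<rho>"

text \<open>Operators on the joint system \<open>QE\<close>, with \<open>Q\<close> of dimension \<open>n\<close> and \<open>E\<close> of dimension \<open>d\<close>.\<close>

definition ptrace_Q :: "nat \<Rightarrow> nat \<Rightarrow> complex mat \<Rightarrow> complex mat" where
  "ptrace_Q n d X = mat d d (\<lambda>(e, e'). \<Sum>q<n. X $$ (q * d + e, q * d + e'))"

definition ptrace_E :: "nat \<Rightarrow> nat \<Rightarrow> complex mat \<Rightarrow> complex mat" where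
  "ptrace_E n d X = mat n n (\<lambda>(q, q'). \<Sum>e<d. X $$ (q * d + e, q' * d + e))"

definition purification :: "nat \<Rightarrow> nat \<Rightarrow> complex mat \<Rightarrow> complex mat \<Rightarrow> bool" where
  "purification n d \<psi> \<rho> \<longleftrightarrow> \<psi> \<in> carrier_mat (n * d) 1 \<and> ptrace_E n d (outer \<psi>) = \<rho>"

text \<open>Each summand is \<open>|i\<rangle>\<langle>i| \<otimes> \<langle>i|\<psi>\<rangle>\<langle>\<psi>|i\<rangle>\<close>, where \<open>\<langle>i|\<close> acts on \<open>Q\<close> only. The sum of matrices
  is written entrywise because the matrix type has no zero independent of the dimension.\<close>

definition measured_state :: "nat \<Rightarrow> nat \<Rightarrow> complex mat \<Rightarrow> complex mat" where
  "measured_state n d \<psi> = mat (n * d) (n * d) (\<lambda>(r, c). \<Sum>i<n.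
     kron (outer (ket n i)) (outer (kron (mat_adjoint (ket n i)) (1\<^sub>m d) * \<psi>)) $$ (r, c))"

definition cond_entropy :: "nat \<Rightarrow> nat \<Rightarrow> complex mat \<Rightarrow> real" where
  "cond_entropy n d X = entropy X - entropy (ptrace_Q n d X)"

text \<open>The value does not depend on the purification, nor on the dimension of \<open>E\<close>, which is why a
  definite description over all purifications is used.\<close>

definition intrinsic_randomness :: "complex mat \<Rightarrow> real" where
  "intrinsic_randomness \<rho> = (THE r. \<exists>d \<psi>. purification (dim_row \<rho>) d \<psi> \<rho> \<and>
     r = cond_entropy (dim_row \<rho>) d (measured_state (dim_row \<rho>) d \<psi>))"

definition six_state_set ::
  "real \<Rightarrow> real \<Rightarrow> real \<Rightarrow> real \<Rightarrow> real \<Rightarrow> real \<Rightarrow> complex mat set" where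
  "six_state_set m00 m11 m22 m33 ex ey = {\<rho>. density_operator 4 \<rho> \<and>
     \<rho> $$ (0, 0) = complex_of_real m00 \<and> \<rho> $$ (1, 1) = complex_of_real m11 \<and>
     \<rho> $$ (2, 2) = complex_of_real m22 \<and> \<rho> $$ (3, 3) = complex_of_real m33 \<and>
     mtrace (Pi_x_minus * \<rho>) = complex_of_real ex \<and>
     mtrace (Pi_y_minus * \<rho>) = complex_of_real ey}"

definition conditional_state :: "complex mat \<Rightarrow> complex mat \<Rightarrow> complex mat" where
  "conditional_state P \<rho> = (1 / mtrace (P * \<rho>)) \<cdot>\<^sub>m (P * \<rho> * P)"

definition sifted_randomness :: "real \<Rightarrow> complex mat \<Rightarrow> real" where
  "sifted_randomness eb \<rho> =
     (if 1 - eb = 0 then 0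
      else (1 - eb) * intrinsic_randomness (conditional_state Pi_plus \<rho>)) +
     (if eb = 0 then 0
      else eb * intrinsic_randomness (sigma_x_B * conditional_state Pi_minus \<rho> * sigma_x_B))"

definition attains_min :: "('a \<Rightarrow> real) \<Rightarrow> 'a set \<Rightarrow> bool" where
  "attains_min f S \<longleftrightarrow> (\<exists>x\<in>S. \<forall>y\<in>S. f x \<le> f y)"

text \<open>Only meaningful if \<open>attains_min f S\<close>.\<close>

definition min_over :: "('a \<Rightarrow> real) \<Rightarrow> 'a set \<Rightarrow> real" where
  "min_over f S = (LEAST v. v \<in> f ` S)"

definition key_rate :: "real \<Rightarrow> complex mat set \<Rightarrow> real" where
  "key_rate eb S = min_over (sifted_randomness eb) S - binary_entropy eb"

definition tau ::
  "real \<Rightarrow> real \<Rightarrow> real \<Rightarrow> real \<Rightarrow> real \<Rightarrow> real \<Rightarrow> complex mat" where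
  "tau m00 m11 m22 m33 ex ey = map_mat complex_of_real (mat_of_rows_list 4
     [[m00, 0, 0, (1 - ex - ey) / 2],
      [0, m11, (ey - ex) / 2, 0],
      [0, (ey - ex) / 2, m22, 0],
      [(1 - ex - ey) / 2, 0, 0, m33]])"

definition K_six_opt ::
  "real \<Rightarrow> real \<Rightarrow> real \<Rightarrow> real \<Rightarrow> real \<Rightarrow> real \<Rightarrow> real \<Rightarrow> real" where
  "K_six_opt m00 m11 m22 m33 ex ey ez =
     coherence (tau m00 m11 m22 m33 ex ey) - binary_entropy ez"

end

theory Submission
  imports Defs "Jordan_Normal_Form.Spectral_Radius"
begin

text \<open>For a purification of \<open>\<rho>\<close> with coefficient matrix \<open>A\<close>, measuring \<open>Q\<close> leaves the state
  \<open>B B\<^sup>*\<close> with \<open>B\<^sup>* B\<close> the diagonal part of \<open>\<rho>\<close>, while \<open>\<rho> = A A\<^sup>*\<close> and the state of \<open>E\<close> is the transpose of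
  \<open>A\<^sup>* A\<close>. Since the entropy depends only on the nonzero spectrum, \<open>R(\<rho>) = C(\<rho>)\<close>. On \<open>S\<close> both
  conditional states and \<open>\<Phi>(\<rho>)\<close> are built from two \<open>2 \<times> 2\<close> blocks with prescribed diagonal
  and off-diagonal entries \<open>a\<close>, \<open>b\<close>. The coherence of a block is homogeneous of degree one, so that the
  two terms of the key rate add up to \<open>C(\<Phi>(\<rho>))\<close>, and it increases with the modulus of the off-diagonal
  entry, because \<open>x log x\<close> is convex. The error rates fix exactly \<open>Re a\<close> and \<open>Re b\<close>; hence the minimum
  is attained where \<open>a\<close> and \<open>b\<close> are real, that is at \<open>\<tau>\<close>.\<close>

section \<open>Power traces and functional calculus\<close>

text \<open>The premises of this rule leave the inner dimensions schematic, which makes the simplifier diverge.\<close>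

declare assoc_mult_mat [simp del]

section \<open>Entries, adjoints and traces of matrix products\<close>

lemma index_mult_mat_sum:
  assumes "A \<in> carrier_mat n m" "B \<in> carrier_mat m k" "i < n" "j < k"
  shows "(A * B) $$ (i, j) = (\<Sum>l<m. A $$ (i, l) * B $$ (l, j))"
  using assms by (auto simp: scalar_prod_def atLeast0LessThan)

lemma dim_mat_adjoint [simp]: "dim_row (mat_adjoint A) = dim_col A" "dim_col (mat_adjoint A) = dim_row A"
  by (auto simp: mat_adjoint_def)

lemma mat_adjoint_carrier [simp]: "A \<in> carrier_mat n m \<Longrightarrow> mat_adjoint A \<in> carrier_mat m n"
  by (rule carrier_matI) auto

lemma index_mat_adjoint [simp]:
  "i < dim_col A \<Longrightarrow> j < dim_row A \<Longrightarrow> mat_adjoint A $$ (i, j) = cnj (A $$ (j, i))"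
  by (simp add: mat_adjoint_def mat_of_rows_index)

lemma mult_square_carrier_mat [simp]:
  "A \<in> carrier_mat n n \<Longrightarrow> B \<in> carrier_mat n n \<Longrightarrow> A * B \<in> carrier_mat n n"
  by (rule mult_carrier_mat)

lemma mult_one_square_mat [simp]:
  fixes A :: "complex mat"
  assumes "A \<in> carrier_mat n n"
  shows "1\<^sub>m n * A = A" "A * 1\<^sub>m n = A"
  using assms by auto

lemma mat_adjoint_adjoint [simp]:
  fixes A :: "complex mat"
  shows "mat_adjoint (mat_adjoint A) = A"
  by (rule eq_matI) auto

lemma mat_adjoint_mult:
  fixes A :: "complex mat"
  assumes "A \<in> carrier_mat n m" "B \<in> carrier_mat m k"
  shows "mat_adjoint (A * B) = mat_adjoint B * mat_adjoint A"
proof (rule eq_matI)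
  fix i j assume "i < dim_row (mat_adjoint B * mat_adjoint A)" "j < dim_col (mat_adjoint B * mat_adjoint A)"
  then have ij: "i < k" "j < n" using assms by auto
  then have "mat_adjoint (A * B) $$ (i, j) = (\<Sum>l<m. cnj (A $$ (j, l)) * cnj (B $$ (l, i)))"
    using assms by (simp add: index_mult_mat_sum[OF assms] del: index_mult_mat(1))
  also have "\<dots> = (\<Sum>l<m. mat_adjoint B $$ (i, l) * mat_adjoint A $$ (l, j))"
    using assms ij by (auto intro!: sum.cong)
  also have "\<dots> = (mat_adjoint B * mat_adjoint A) $$ (i, j)"
    using assms ij by (subst index_mult_mat_sum[of _ k m _ n]) auto
  finally show "mat_adjoint (A * B) $$ (i, j) = (mat_adjoint B * mat_adjoint A) $$ (i, j)" .
qed (use assms in auto)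

lemma unitary_right_inverse:
  assumes "U \<in> carrier_mat n n" "mat_adjoint U * U = 1\<^sub>m n"
  shows "U * mat_adjoint U = 1\<^sub>m n"
  using assms mat_mult_left_right_inverse mat_adjoint_carrier by metis

lemma mtrace_mult_commute:
  assumes A: "A \<in> carrier_mat n m" and B: "B \<in> carrier_mat m n"
  shows "mtrace (A * B) = mtrace (B * A)"
proof -
  have "mtrace (A * B) = (\<Sum>i<n. \<Sum>l<m. A $$ (i, l) * B $$ (l, i))"
    using A by (auto simp: mtrace_def index_mult_mat_sum[OF A B] simp del: index_mult_mat(1) intro!: sum.cong)
  also have "\<dots> = (\<Sum>l<m. \<Sum>i<n. B $$ (l, i) * A $$ (i, l))"
    by (subst sum.swap) (simp add: mult.commute)
  also have "\<dots> = mtrace (B * A)"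
    using B by (auto simp: mtrace_def index_mult_mat_sum[OF B A] simp del: index_mult_mat(1) intro!: sum.cong)
  finally show ?thesis .
qed

lemma mtrace_mat_diag: "mtrace (mat_diag n f) = (\<Sum>i<n. f i)"
  by (auto simp: mtrace_def mat_diag_def)

text \<open>Reassociation moves one factor \<open>A\<close> from the right end of the alternating
  product to the left; this makes cyclicity of the trace usable for powers.\<close>

lemma mult_pow_mat_commute:
  fixes A B :: "complex mat"
  assumes A: "A \<in> carrier_mat n m" and B: "B \<in> carrier_mat m n"
  shows "(A * B) ^\<^sub>m k * A = A * (B * A) ^\<^sub>m k"
proof (induction k)
  case 0
  then show ?case using A B by auto
next
  case (Suc k)
  have AB: "A * B \<in> carrier_mat n n" and BA: "B * A \<in> carrier_mat m m" using A B by auto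
  have "(A * B) ^\<^sub>m Suc k * A = (A * B) ^\<^sub>m k * ((A * B) * A)"
    unfolding pow_mat.simps by (rule assoc_mult_mat[OF pow_carrier_mat[OF AB] AB A])
  also have "(A * B) * A = A * (B * A)"
    by (rule assoc_mult_mat[OF A B A])
  also have "(A * B) ^\<^sub>m k * (A * (B * A)) = ((A * B) ^\<^sub>m k * A) * (B * A)"
    by (rule assoc_mult_mat[OF pow_carrier_mat[OF AB] A BA, symmetric])
  also have "\<dots> = A * (B * A) ^\<^sub>m k * (B * A)"
    using Suc by simp
  also have "\<dots> = A * (B * A) ^\<^sub>m Suc k"
    unfolding pow_mat.simps by (rule assoc_mult_mat[OF A pow_carrier_mat[OF BA] BA])
  finally show ?case .
qed

text \<open>Splitting off one factor turns the power into
  \<open>A * ((B * A) ^\<^sub>m l * B)\<close>, to which cyclicity applies. At \<open>k = 0\<close>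
  the traces would be the dimensions \<open>n\<close> and \<open>m\<close>, hence
  \<open>k > 0\<close>.\<close>

lemma mtrace_pow_mult_commute:
  assumes A: "A \<in> carrier_mat n m" and B: "B \<in> carrier_mat m n" and "k > 0"
  shows "mtrace ((A * B) ^\<^sub>m k) = mtrace ((B * A) ^\<^sub>m k)"
proof -
  obtain l where k: "k = Suc l" using \<open>k > 0\<close> gr0_implies_Suc by blast
  have AB: "A * B \<in> carrier_mat n n" and BA: "B * A \<in> carrier_mat m m" using A B by auto
  have "(A * B) ^\<^sub>m k = (A * B) ^\<^sub>m l * A * B"
    unfolding k pow_mat.simps by (rule assoc_mult_mat[OF pow_carrier_mat[OF AB] A B, symmetric])
  also have "\<dots> = A * ((B * A) ^\<^sub>m l * B)"
    unfolding mult_pow_mat_commute[OF A B] by (rule assoc_mult_mat[OF A pow_carrier_mat[OF BA] B])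
  finally have "mtrace ((A * B) ^\<^sub>m k) = mtrace ((B * A) ^\<^sub>m l * B * A)"
    using mtrace_mult_commute[OF A mult_carrier_mat[OF pow_carrier_mat[OF BA] B]] by simp
  also have "(B * A) ^\<^sub>m l * B * A = (B * A) ^\<^sub>m k"
    unfolding k pow_mat.simps by (rule assoc_mult_mat[OF pow_carrier_mat[OF BA] B A])
  finally show ?thesis .
qed

text \<open>The condition that \<open>hermitian_fun\<close> imposes on its witnesses
  \<open>U\<close> and \<open>d\<close>.\<close>

definition spectral_decomp :: "complex mat \<Rightarrow> complex mat \<Rightarrow> (nat \<Rightarrow> real) \<Rightarrow> bool" where
  "spectral_decomp A U d \<longleftrightarrow> (let n = dim_row A in
     U \<in> carrier_mat n n \<and> mat_adjoint U * U = 1\<^sub>m n \<and>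
     A = U * mat_diag n (\<lambda>i. complex_of_real (d i)) * mat_adjoint U)"

lemma mtrace_pow_spectral:
  assumes "spectral_decomp A U d"
  shows "mtrace (A ^\<^sub>m k) = (\<Sum>i<dim_row A. complex_of_real (d i ^ k))"
proof -
  define n where "n = dim_row A"
  define D where "D = mat_diag n (\<lambda>i. complex_of_real (d i))"
  have U: "U \<in> carrier_mat n n" "mat_adjoint U * U = 1\<^sub>m n" "A = U * D * mat_adjoint U"
    using assms unfolding spectral_decomp_def Let_def n_def[symmetric] D_def by blast+
  have D: "D \<in> carrier_mat n n" by (simp add: D_def)
  have "similar_mat_wit A D U (mat_adjoint U)"
    by (rule similar_mat_witI[of _ _ n]) (use U D unitary_right_inverse in auto)
  then have "A ^\<^sub>m k = U * D ^\<^sub>m k * mat_adjoint U"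
    by (rule similar_mat_wit_pow_id)
  then have "mtrace (A ^\<^sub>m k) = mtrace (mat_adjoint U * (U * D ^\<^sub>m k))"
    using mtrace_mult_commute[of "U * D ^\<^sub>m k" n n "mat_adjoint U"] U D by simp
  also have "mat_adjoint U * (U * D ^\<^sub>m k) = D ^\<^sub>m k"
    using U D by (simp flip: assoc_mult_mat[of _ n n _ n _ n])
  also have "D ^\<^sub>m k = mat_diag n (\<lambda>i. complex_of_real (d i ^ k))"
    unfolding D_def
  proof (induction k)
    case 0
    then show ?case by (simp add: mat_diag_def one_mat_def)
  qed (simp add: mult.commute)
  finally show ?thesis by (simp add: mtrace_mat_diag n_def)
qed

text \<open>The definite description denotes: the change of basis \<open>W\<close> between two
  decompositions intertwines their diagonal matrices, and hence also the images of these under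
  \<open>f\<close>.\<close>

lemma hermitian_fun_eqI:
  assumes "spectral_decomp A U d"
  shows "hermitian_fun f A = U * mat_diag (dim_row A) (\<lambda>i. complex_of_real (f (d i))) * mat_adjoint U"
proof -
  define n where "n = dim_row A"
  define D where "D g = mat_diag n (\<lambda>i. complex_of_real (g i))" for g :: "nat \<Rightarrow> real"
  have D [simp]: "D g \<in> carrier_mat n n" for g by (simp add: D_def)
  have U: "U \<in> carrier_mat n n" "mat_adjoint U * U = 1\<^sub>m n" "A = U * D d * mat_adjoint U"
    using assms unfolding spectral_decomp_def Let_def n_def[symmetric] D_def by blast+
  have uniq: "V * D (\<lambda>i. f (e i)) * mat_adjoint V = U * D (\<lambda>i. f (d i)) * mat_adjoint U"
    if V: "V \<in> carrier_mat n n" "mat_adjoint V * V = 1\<^sub>m n" "A = V * D e * mat_adjoint V" for V e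
  proof -
    define W where "W = mat_adjoint V * U"
    have W: "W \<in> carrier_mat n n" using U V by (simp add: W_def)
    note assoc = assoc_mult_mat[of _ n n _ n _ n]
    have VV: "V * mat_adjoint V = 1\<^sub>m n" and UU: "U * mat_adjoint U = 1\<^sub>m n"
      using unitary_right_inverse U V by auto
    have "W * D d = mat_adjoint V * (U * D d * (mat_adjoint U * U))"
      using U(1) V(1) unfolding U(2) by (simp add: W_def assoc)
    also have "\<dots> = mat_adjoint V * (A * U)"
      unfolding U(3) using U(1) V(1) by (simp add: assoc)
    also have "\<dots> = (mat_adjoint V * V) * D e * W"
      unfolding V(3) using U(1) V(1) by (simp add: assoc W_def)
    also have "\<dots> = D e * W"
      using V W by simp
    finally have WD: "W * D d = D e * W" .
    \<comment> \<open>An entry of \<open>W\<close> can be nonzero only where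
      \<open>d j = e i\<close>, and there \<open>f\<close> takes the same value on both
      sides.\<close>
    have "W $$ (i, j) * complex_of_real (f (d j)) = complex_of_real (f (e i)) * W $$ (i, j)"
      if "i < n" "j < n" for i j
    proof -
      have "(W * D d) $$ (i, j) = (D e * W) $$ (i, j)" by (simp add: WD)
      then have "W $$ (i, j) * complex_of_real (d j) = complex_of_real (e i) * W $$ (i, j)"
        using that W by (simp add: D_def mat_diag_mult_right[OF W] mat_diag_mult_left[OF W])
      then have "W $$ (i, j) = 0 \<or> d j = e i"
        by (simp add: mult.commute)
      then show ?thesis by (auto simp: mult.commute)
    qed
    then have WD': "W * D (\<lambda>i. f (d i)) = D (\<lambda>i. f (e i)) * W"
      unfolding D_def mat_diag_mult_right[OF W] mat_diag_mult_left[OF W]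
      by (intro eq_matI) auto
    have "U * D (\<lambda>i. f (d i)) * mat_adjoint U = (V * mat_adjoint V) * U * D (\<lambda>i. f (d i)) * mat_adjoint U"
      unfolding VV using U(1) by simp
    also have "\<dots> = V * (W * D (\<lambda>i. f (d i))) * mat_adjoint U"
      using U(1) V(1) by (simp add: assoc W_def)
    also have "\<dots> = V * D (\<lambda>i. f (e i)) * mat_adjoint V * (U * mat_adjoint U)"
      unfolding WD' using U(1) V(1) by (simp add: assoc W_def)
    also have "\<dots> = V * D (\<lambda>i. f (e i)) * mat_adjoint V"
      unfolding UU using V(1) by (simp add: assoc)
    finally show ?thesis by simp
  qed
  show ?thesis
    unfolding hermitian_fun_def n_def[symmetric] Let_def
  proof (rule the_equality)
    show "\<exists>V e. V \<in> carrier_mat n n \<and> mat_adjoint V * V = 1\<^sub>m n \<and>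
        A = V * mat_diag n (\<lambda>i. complex_of_real (e i)) * mat_adjoint V \<and>
        U * mat_diag n (\<lambda>i. complex_of_real (f (d i))) * mat_adjoint U =
        V * mat_diag n (\<lambda>i. complex_of_real (f (e i))) * mat_adjoint V"
      using U unfolding D_def by blast
  next
    fix B
    assume "\<exists>V e. V \<in> carrier_mat n n \<and> mat_adjoint V * V = 1\<^sub>m n \<and>
        A = V * mat_diag n (\<lambda>i. complex_of_real (e i)) * mat_adjoint V \<and>
        B = V * mat_diag n (\<lambda>i. complex_of_real (f (e i))) * mat_adjoint V"
    then show "B = U * mat_diag n (\<lambda>i. complex_of_real (f (d i))) * mat_adjoint U"
      using uniq unfolding D_def by blast
  qed
qed

lemma entropy_spectral:
  assumes "spectral_decomp A U d"
  shows "entropy A = - (\<Sum>i<dim_row A. d i * log 2 (d i))"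
proof -
  define n where "n = dim_row A"
  define D where "D g = mat_diag n (\<lambda>i. complex_of_real (g i))" for g :: "nat \<Rightarrow> real"
  have D [simp]: "D g \<in> carrier_mat n n" for g by (simp add: D_def)
  have U: "U \<in> carrier_mat n n" "mat_adjoint U * U = 1\<^sub>m n" "A = U * D d * mat_adjoint U"
    using assms unfolding spectral_decomp_def Let_def n_def[symmetric] D_def by blast+
  note assoc = assoc_mult_mat[of _ n n _ n _ n]
  let ?E = "D (\<lambda>i. log 2 (d i))"
  have "A * hermitian_fun (log 2) A = (U * D d * mat_adjoint U) * (U * ?E * mat_adjoint U)"
    using arg_cong2[OF U(3) hermitian_fun_eqI[OF assms, of "log 2"], of "(*)"]
    unfolding D_def n_def[symmetric] .
  also have "\<dots> = U * (D d * (mat_adjoint U * U) * ?E) * mat_adjoint U"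
    using U(1) by (simp add: assoc)
  also have "\<dots> = U * (D d * ?E) * mat_adjoint U"
    unfolding U(2) by simp
  finally have "mtrace (A * hermitian_fun (log 2) A) = mtrace (mat_adjoint U * (U * (D d * ?E)))"
    using mtrace_mult_commute[of "U * (D d * ?E)" n n "mat_adjoint U"] U(1) by simp
  also have "mat_adjoint U * (U * (D d * ?E)) = (mat_adjoint U * U) * (D d * ?E)"
    using U(1) by (simp add: assoc)
  also have "\<dots> = D d * ?E"
    unfolding U(2) by simp
  also have "mtrace (D d * ?E) = complex_of_real (\<Sum>i<n. d i * log 2 (d i))"
    by (simp add: D_def mtrace_mat_diag)
  finally show ?thesis by (simp add: entropy_def n_def)
qed

section \<open>The spectral theorem for Hermitian matrices\<close>

lemma cscalar_prod_self:
  fixes v :: "complex vec"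
  shows "v \<bullet>c v = complex_of_real (\<Sum>i<dim_vec v. (cmod (v $ i))\<^sup>2)"
  unfolding of_real_sum complex_norm_square by (simp add: scalar_prod_def atLeast0LessThan)

text \<open>Complete \<open>v\<close> to a basis, apply Gram-Schmidt, which keeps the first vector,
  and normalise. The result is the change of basis that splits off an eigenvector in the spectral
  theorem.\<close>

lemma unitary_completion:
  fixes v :: "complex vec"
  assumes v: "v \<in> carrier_vec n" "v \<noteq> 0\<^sub>v n"
  shows "\<exists>W c. W \<in> carrier_mat n n \<and> mat_adjoint W * W = 1\<^sub>m n \<and> col W 0 = c \<cdot>\<^sub>v v \<and> c \<noteq> 0"
proof -
  interpret cof_vec_space n "TYPE(complex)" .
  have n: "n > 0" using v by (cases n) auto
  define b where "b = basis_completion v"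
  define ws where "ws = gram_schmidt n b"
  note b = basis_completion[OF v, folded b_def]
  have ws: "set ws \<subseteq> carrier_vec n" "corthogonal ws" "length ws = n"
    using gram_schmidt_result[OF b(2,4,5), of ws] b(6) by (auto simp: ws_def)
  obtain vs where "b = v # vs" using b(6,7) n by (cases b) auto
  then have "hd ws = v" using gram_schmidt_hd[OF v(1), of vs] by (simp add: ws_def)
  then have ws0: "ws ! 0 = v" using ws(3) n by (cases ws) auto
  \<comment> \<open>The squared norms of the orthogonal vectors; their roots normalise the columns
    of \<open>W\<close>.\<close>
  define r where "r i = (\<Sum>l<n. (cmod (ws ! i $ l))\<^sup>2)" for i
  have carr: "ws ! i \<in> carrier_vec n" if "i < n" for i using that ws by auto
  have self: "ws ! i \<bullet>c ws ! i = complex_of_real (r i)" if "i < n" for i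
    using cscalar_prod_self[of "ws ! i"] carr[OF that] unfolding r_def by (metis carrier_vecD)
  have r0: "r i > 0" if "i < n" for i
  proof -
    have "ws ! i \<bullet>c ws ! i \<noteq> 0" using corthogonalD[OF ws(2), of i i] that ws(3) by simp
    then have "r i \<noteq> 0" using self[OF that] by simp
    moreover have "r i \<ge> 0" by (simp add: r_def sum_nonneg)
    ultimately show ?thesis by simp
  qed
  define W where "W = mat n n (\<lambda>(i, j). ws ! j $ i / complex_of_real (sqrt (r j)))"
  have W: "W \<in> carrier_mat n n" by (simp add: W_def)
  have "mat_adjoint W * W = 1\<^sub>m n"
  proof (rule eq_matI)
    fix i j assume "i < dim_row (1\<^sub>m n :: complex mat)" "j < dim_col (1\<^sub>m n :: complex mat)"
    then have ij: "i < n" "j < n" by auto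
    have "(mat_adjoint W * W) $$ (i, j) = (\<Sum>l<n. cnj (W $$ (l, i)) * W $$ (l, j))"
      using W ij by (subst index_mult_mat_sum[of _ n n _ n]) auto
    also have "\<dots> = (\<Sum>l<n. ws ! j $ l * cnj (ws ! i $ l)) / complex_of_real (sqrt (r i) * sqrt (r j))"
      using ij by (simp add: W_def sum_divide_distrib mult_ac)
    also have "(\<Sum>l<n. ws ! j $ l * cnj (ws ! i $ l)) = ws ! j \<bullet>c ws ! i"
      using carr[OF ij(1)] carr[OF ij(2)] by (simp add: scalar_prod_def atLeast0LessThan)
    also have "ws ! j \<bullet>c ws ! i / complex_of_real (sqrt (r i) * sqrt (r j)) = (if i = j then 1 else 0)"
    proof (cases "i = j")
      case True
      have "sqrt (r j) * sqrt (r j) = r j" using r0[OF ij(2)] by simp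
      then show ?thesis using True self[OF ij(2)] r0[OF ij(2)] by simp
    next
      case False
      then show ?thesis using corthogonalD[OF ws(2), of j i] ij ws(3) by simp
    qed
    finally show "(mat_adjoint W * W) $$ (i, j) = 1\<^sub>m n $$ (i, j)" using ij by simp
  qed (use W in auto)
  moreover have "col W 0 = complex_of_real (1 / sqrt (r 0)) \<cdot>\<^sub>v v"
    using n v(1) ws0 by (intro eq_vecI) (auto simp: W_def)
  moreover have "complex_of_real (1 / sqrt (r 0)) \<noteq> 0" using r0[OF n] by simp
  ultimately show ?thesis using W by blast
qed

lemma mat_adjoint_four_block:
  fixes A :: "complex mat"
  assumes "A \<in> carrier_mat a a'" "B \<in> carrier_mat a b'" "C \<in> carrier_mat b a'" "D \<in> carrier_mat b b'"
  shows "mat_adjoint (four_block_mat A B C D) =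
    four_block_mat (mat_adjoint A) (mat_adjoint C) (mat_adjoint B) (mat_adjoint D)"
  by (rule eq_matI) (use assms in auto)

text \<open>Induction on the dimension by deflation: in an orthonormal basis that starts with an
  eigenvector, the matrix splits into the eigenvalue and a Hermitian block of size
  \<open>n\<close>.\<close>

theorem hermitian_spectral_decomp:
  assumes "A \<in> carrier_mat n n" "mat_adjoint A = A"
  shows "\<exists>U d. spectral_decomp A U d"
  using assms
proof (induction n arbitrary: A)
  case 0
  have "spectral_decomp A (1\<^sub>m 0) (\<lambda>_. 0)"
    unfolding spectral_decomp_def Let_def using 0 by (auto simp: mat_diag_def intro!: eq_matI)
  then show ?case by blast
next
  case (Suc n)
  let ?N = "Suc n"
  note assoc = assoc_mult_mat[of _ ?N ?N _ ?N _ ?N]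
  have A: "A \<in> carrier_mat ?N ?N" and hA: "mat_adjoint A = A" by fact+
  obtain e where "eigenvalue A e"
    using spectrum_non_empty[OF A] by (auto simp: spectrum_def)
  then obtain v where v: "v \<in> carrier_vec ?N" "v \<noteq> 0\<^sub>v ?N" "A *\<^sub>v v = e \<cdot>\<^sub>v v"
    using A unfolding eigenvalue_def eigenvector_def by auto
  obtain W c where W: "W \<in> carrier_mat ?N ?N" "mat_adjoint W * W = 1\<^sub>m ?N" "col W 0 = c \<cdot>\<^sub>v v" "c \<noteq> 0"
    using unitary_completion[OF v(1,2)] by blast
  note WW = unitary_right_inverse[OF W(1,2)]
  define B where "B = mat_adjoint W * A * W"
  have B: "B \<in> carrier_mat ?N ?N" using A W by (simp add: B_def)
  have hB: "mat_adjoint B = B"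
    using A W hA by (simp add: B_def mat_adjoint_mult[of _ ?N ?N _ ?N] assoc)
  have AB: "A = W * B * mat_adjoint W"
  proof -
    have "W * B * mat_adjoint W = (W * mat_adjoint W) * A * (W * mat_adjoint W)"
      using A W(1) by (simp add: B_def assoc)
    then show ?thesis using A by (simp add: WW)
  qed
  \<comment> \<open>Column \<open>0\<close> of \<open>W\<close> is an eigenvector of
    \<open>A\<close>, so column \<open>0\<close> of \<open>B\<close> is \<open>e\<close> times that
    of \<open>mat_adjoint W * W\<close>, the identity.\<close>
  have B0: "B $$ (i, 0) = (if i = 0 then e else 0)" if i: "i < ?N" for i
  proof -
    have "col (A * W) 0 = A *\<^sub>v (c \<cdot>\<^sub>v v)"
      by (simp only: col_mult2[OF A W(1) zero_less_Suc] W(3))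
    also have "\<dots> = e \<cdot>\<^sub>v col W 0"
      using A v by (simp add: W(3) mult_mat_vec[of _ ?N ?N] smult_smult_assoc mult.commute)
    finally have colW: "col (A * W) 0 = e \<cdot>\<^sub>v col W 0" .
    have AW: "(A * W) $$ (l, 0) = e * W $$ (l, 0)" if "l < ?N" for l
      using that A W(1) arg_cong[OF colW, of "\<lambda>v. v $ l"] by simp
    have "B $$ (i, 0) = (mat_adjoint W * (A * W)) $$ (i, 0)"
      using A W by (simp add: B_def assoc)
    also have "\<dots> = (\<Sum>l<?N. mat_adjoint W $$ (i, l) * (e * W $$ (l, 0)))"
      using A W i by (subst index_mult_mat_sum[of _ ?N ?N _ ?N]) (simp_all add: AW del: index_mult_mat(1) sum.lessThan_Suc)
    also have "\<dots> = e * (\<Sum>l<?N. mat_adjoint W $$ (i, l) * W $$ (l, 0))"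
      by (simp add: sum_distrib_left mult_ac del: sum.lessThan_Suc)
    also have "\<dots> = e * (mat_adjoint W * W) $$ (i, 0)"
      using W i by (subst index_mult_mat_sum[of _ ?N ?N _ ?N]) simp_all
    finally show ?thesis using W i by simp
  qed
  have Bsym: "B $$ (i, j) = cnj (B $$ (j, i))" if "i < ?N" "j < ?N" for i j
  proof -
    have "B $$ (i, j) = mat_adjoint B $$ (i, j)" by (simp only: hB)
    also have "\<dots> = cnj (B $$ (j, i))" using that B by simp
    finally show ?thesis .
  qed
  \<comment> \<open>The eigenvalue is a diagonal entry of the Hermitian matrix \<open>B\<close>,
    hence its own conjugate.\<close>
  have e_real: "complex_of_real (Re e) = e"
    using Bsym[of 0 0] unfolding B0[OF zero_less_Suc] by (simp add: complex_eq_iff)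
  define B' where "B' = mat n n (\<lambda>(i, j). B $$ (Suc i, Suc j))"
  have B': "B' \<in> carrier_mat n n" "mat_adjoint B' = B'"
    by (auto simp: B'_def simp flip: Bsym intro!: eq_matI)
  have Bblock: "B = four_block_mat (mat 1 1 (\<lambda>_. e)) (0\<^sub>m 1 n) (0\<^sub>m n 1) B'"
  proof (rule eq_matI)
    fix i j assume "i < dim_row (four_block_mat (mat 1 1 (\<lambda>_. e)) (0\<^sub>m 1 n) (0\<^sub>m n 1) B')"
      "j < dim_col (four_block_mat (mat 1 1 (\<lambda>_. e)) (0\<^sub>m 1 n) (0\<^sub>m n 1) B')"
    then have ij: "i < ?N" "j < ?N" by (auto simp: B'_def)
    have "B $$ (0, j) = (if j = 0 then e else 0)"
      using Bsym[OF zero_less_Suc ij(2)] B0[OF ij(2)] e_real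
      by (metis complex_cnj_complex_of_real complex_cnj_zero)
    then show "B $$ (i, j) = four_block_mat (mat 1 1 (\<lambda>_. e)) (0\<^sub>m 1 n) (0\<^sub>m n 1) B' $$ (i, j)"
      using ij B0[of i] by (cases i; cases j) (auto simp: B'_def)
  qed (use B in \<open>auto simp: B'_def\<close>)
  obtain U d where "spectral_decomp B' U d"
    using Suc.IH[OF B'] by blast
  then have U: "U \<in> carrier_mat n n" "mat_adjoint U * U = 1\<^sub>m n"
    "B' = U * mat_diag n (\<lambda>i. complex_of_real (d i)) * mat_adjoint U"
    using B'(1) unfolding spectral_decomp_def Let_def by auto
  \<comment> \<open>The unitary from the induction hypothesis, extended to fix the eigenvector;
    \<open>W * P\<close> then diagonalises \<open>A\<close>.\<close>
  define P where "P = four_block_mat (1\<^sub>m 1) (0\<^sub>m 1 n) (0\<^sub>m n 1) U"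
  define d' where "d' i = (case i of 0 \<Rightarrow> Re e | Suc i \<Rightarrow> d i)" for i
  have P: "P \<in> carrier_mat ?N ?N" using U(1) by (auto simp: P_def)
  have "mat_adjoint (1\<^sub>m k) = (1\<^sub>m k :: complex mat)" for k by (rule eq_matI) auto
  moreover have "mat_adjoint (0\<^sub>m k l) = (0\<^sub>m l k :: complex mat)" for k l by (rule eq_matI) auto
  ultimately have Padj: "mat_adjoint P = four_block_mat (1\<^sub>m 1) (0\<^sub>m 1 n) (0\<^sub>m n 1) (mat_adjoint U)"
    using U(1) unfolding P_def by (subst mat_adjoint_four_block[of _ 1 1 _ n _ n]) auto
  have mult_block: "four_block_mat X (0\<^sub>m 1 n) (0\<^sub>m n 1) Y * four_block_mat X' (0\<^sub>m 1 n) (0\<^sub>m n 1) Y' =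
      four_block_mat (X * X') (0\<^sub>m 1 n) (0\<^sub>m n 1) (Y * Y')"
    if "X \<in> carrier_mat 1 1" "X' \<in> carrier_mat 1 1" "Y \<in> carrier_mat n n" "Y' \<in> carrier_mat n n"
    for X X' Y Y' :: "complex mat"
    using that by (subst mult_four_block_mat[of _ 1 1 _ n _ n _ _ 1 _ n])
      (auto simp: left_mult_zero_mat[of _ n] right_mult_zero_mat[of _ n])
  have PP: "mat_adjoint P * P = 1\<^sub>m ?N"
    unfolding Padj unfolding P_def using U
    by (subst mult_block) (simp_all add: four_block_one_mat[of 1 n, simplified])
  have D: "mat_diag ?N (\<lambda>i. complex_of_real (d' i)) =
      four_block_mat (mat 1 1 (\<lambda>_. e)) (0\<^sub>m 1 n) (0\<^sub>m n 1) (mat_diag n (\<lambda>i. complex_of_real (d i)))"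
    by (rule eq_matI) (auto simp: mat_diag_def d'_def e_real split: nat.splits)
  have BP: "B = P * mat_diag ?N (\<lambda>i. complex_of_real (d' i)) * mat_adjoint P"
  proof -
    have 1: "mat 1 1 (\<lambda>_. e) \<in> carrier_mat 1 1" and D': "mat_diag n (\<lambda>i. complex_of_real (d i)) \<in> carrier_mat n n"
      by simp_all
    show ?thesis
      unfolding D Padj unfolding P_def Bblock
        mult_block[OF one_carrier_mat 1 U(1) D']
        mult_block[OF mult_carrier_mat[OF one_carrier_mat 1] one_carrier_mat mult_carrier_mat[OF U(1) D']
          mat_adjoint_carrier[OF U(1)]]
      using U(3) by simp
  qed
  have "spectral_decomp A (W * P) d'"
    unfolding spectral_decomp_def Let_def
  proof (intro conjI)
    have dim: "dim_row A = ?N" using A by simp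
    have adj: "mat_adjoint (W * P) = mat_adjoint P * mat_adjoint W"
      using W(1) P by (rule mat_adjoint_mult)
    show "W * P \<in> carrier_mat (dim_row A) (dim_row A)" using W(1) P dim by simp
    have "mat_adjoint (W * P) * (W * P) = mat_adjoint P * (mat_adjoint W * W) * P"
      unfolding adj using W(1) P by (simp add: assoc)
    then show "mat_adjoint (W * P) * (W * P) = 1\<^sub>m (dim_row A)"
      unfolding W(2) dim using P PP by simp
    show "A = W * P * mat_diag (dim_row A) (\<lambda>i. complex_of_real (d' i)) * mat_adjoint (W * P)"
      unfolding adj dim using AB W(1) P by (simp add: BP assoc)
  qed
  then show ?case by blast
qed

section \<open>Intrinsic randomness is coherence\<close>

text \<open>Newton's step: correct \<open>p\<close> at the new node by a multiple of the polynomial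
  \<open>q\<close> that vanishes at all the old ones.\<close>

lemma interpolating_poly:
  fixes f :: "real \<Rightarrow> real"
  assumes "finite X"
  shows "\<exists>p. \<forall>x\<in>X. poly p x = f x"
  using assms
proof (induction X)
  case (insert x X)
  then obtain p where p: "\<forall>y\<in>X. poly p y = f y" by blast
  define q where "q = (\<Prod>y\<in>X. [:- y, 1:])"
  have q: "poly q y = 0 \<longleftrightarrow> y \<in> X" for y
    using insert.hyps(1) by (auto simp: q_def poly_prod)
  show ?case
    by (rule exI[of _ "p + smult ((f x - poly p x) / poly q x) q"])
      (use p q insert.hyps(2) in auto)
qed simp

text \<open>Two finite families with equal power sums agree up to order and zeros, so that they cannot be
  told apart by \<open>f\<close>; this is seen by interpolating \<open>f\<close> by a polynomial without constant term.\<close>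

lemma sum_eq_of_power_sums_eq:
  fixes f :: "real \<Rightarrow> real"
  assumes "finite I" "finite J" "f 0 = 0"
    and "\<And>k. k > 0 \<Longrightarrow> (\<Sum>i\<in>I. a i ^ k) = (\<Sum>j\<in>J. b j ^ k)"
  shows "(\<Sum>i\<in>I. f (a i)) = (\<Sum>j\<in>J. f (b j))"
proof -
  obtain p where p: "\<And>x. x \<in> insert 0 (a ` I \<union> b ` J) \<Longrightarrow> poly p x = f x"
    using interpolating_poly[of "insert 0 (a ` I \<union> b ` J)" f] assms(1,2) by auto
  \<comment> \<open>The exponent \<open>0\<close>, where the power sums count the members of the two
    families, thus does not contribute.\<close>
  have "coeff p 0 = 0" using p[of 0] assms(3) by (simp add: poly_0_coeff_0)
  then have eq: "coeff p k * (\<Sum>i\<in>I. a i ^ k) = coeff p k * (\<Sum>j\<in>J. b j ^ k)" for k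
    using assms(4)[of k] by (cases "k = 0") auto
  have "(\<Sum>i\<in>I. f (a i)) = (\<Sum>i\<in>I. poly p (a i))"
    by (rule sum.cong) (simp_all add: p)
  also have "\<dots> = (\<Sum>k\<le>degree p. coeff p k * (\<Sum>i\<in>I. a i ^ k))"
    unfolding poly_altdef sum_distrib_left by (rule sum.swap)
  also have "\<dots> = (\<Sum>k\<le>degree p. coeff p k * (\<Sum>j\<in>J. b j ^ k))"
    by (simp only: eq)
  also have "\<dots> = (\<Sum>j\<in>J. poly p (b j))"
    unfolding poly_altdef sum_distrib_left by (rule sum.swap)
  also have "\<dots> = (\<Sum>j\<in>J. f (b j))"
    by (rule sum.cong) (simp_all add: p)
  finally show ?thesis .
qed

text \<open>Vanishes at \<open>0\<close> because \<open>log 2 0 = 0\<close>, as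
  \<open>sum_eq_of_power_sums_eq\<close> demands of \<open>f\<close>.\<close>

definition xlog :: "real \<Rightarrow> real" where
  "xlog x = x * log 2 x"

text \<open>The family \<open>l\<close> stands in for the eigenvalues once its power sums are right,
  so an entropy can be computed without exhibiting eigenvectors.\<close>

lemma entropy_eq_of_power_traces:
  assumes "A \<in> carrier_mat n n" "mat_adjoint A = A" "finite I"
    and tr: "\<And>k. k > 0 \<Longrightarrow> mtrace (A ^\<^sub>m k) = (\<Sum>i\<in>I. complex_of_real (l i ^ k))"
  shows "entropy A = - (\<Sum>i\<in>I. xlog (l i))"
proof -
  obtain U d where Ud: "spectral_decomp A U d"
    using hermitian_spectral_decomp[OF assms(1,2)] by blast
  have "(\<Sum>i<n. d i ^ k) = (\<Sum>i\<in>I. l i ^ k)" if "k > 0" for k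
  proof -
    have "complex_of_real (\<Sum>i<n. d i ^ k) = complex_of_real (\<Sum>i\<in>I. l i ^ k)"
      unfolding of_real_sum using trans[OF mtrace_pow_spectral[OF Ud, symmetric] tr[OF that]]
      unfolding carrier_matD(1)[OF assms(1)] .
    then show ?thesis by (simp only: of_real_eq_iff)
  qed
  then have "(\<Sum>i<n. xlog (d i)) = (\<Sum>i\<in>I. xlog (l i))"
    by (rule sum_eq_of_power_sums_eq[rotated 3]) (use \<open>finite I\<close> in \<open>auto simp: xlog_def\<close>)
  then show ?thesis
    using entropy_spectral[OF Ud] assms(1) by (simp add: xlog_def)
qed

text \<open>The sizes \<open>n\<close> and \<open>m\<close> may differ, which is what comparing
  \<open>A * mat_adjoint A\<close> with \<open>mat_adjoint A * A\<close> calls for.\<close>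

lemma entropy_cong_power_traces:
  assumes "A \<in> carrier_mat n n" "mat_adjoint A = A" "B \<in> carrier_mat m m" "mat_adjoint B = B"
    and "\<And>k. k > 0 \<Longrightarrow> mtrace (A ^\<^sub>m k) = mtrace (B ^\<^sub>m k)"
  shows "entropy A = entropy B"
proof -
  obtain U d where Ud: "spectral_decomp B U d"
    using hermitian_spectral_decomp[OF assms(3,4)] by blast
  have "entropy A = - (\<Sum>i<m. xlog (d i))"
    by (rule entropy_eq_of_power_traces[OF assms(1,2)])
      (use assms(3) in \<open>simp_all add: assms(5) mtrace_pow_spectral[OF Ud]\<close>)
  then show ?thesis using entropy_spectral[OF Ud] assms(3) by (simp add: xlog_def)
qed

lemma entropy_mult_adjoint_commute:
  assumes A: "A \<in> carrier_mat n m"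
  shows "entropy (A * mat_adjoint A) = entropy (mat_adjoint A * A)"
proof (rule entropy_cong_power_traces)
  show "A * mat_adjoint A \<in> carrier_mat n n" "mat_adjoint A * A \<in> carrier_mat m m"
    using A by auto
  show "mat_adjoint (A * mat_adjoint A) = A * mat_adjoint A"
    "mat_adjoint (mat_adjoint A * A) = mat_adjoint A * A"
    using mat_adjoint_mult[OF A mat_adjoint_carrier[OF A]] mat_adjoint_mult[OF mat_adjoint_carrier[OF A] A]
    by simp_all
qed (rule mtrace_pow_mult_commute[OF A mat_adjoint_carrier[OF A]])

lemma transpose_pow_mat:
  fixes A :: "complex mat"
  assumes A: "A \<in> carrier_mat n n"
  shows "transpose_mat A ^\<^sub>m k = transpose_mat (A ^\<^sub>m k)"
proof (induction k)
  case 0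
  then show ?case using A by simp
next
  case (Suc k)
  \<comment> \<open>Transposition reverses factors, so \<open>A\<close> is first moved to the left
    of its own power; this is \<open>mult_pow_mat_commute\<close> with the identity as second
    factor.\<close>
  have "transpose_mat (A ^\<^sub>m Suc k) = transpose_mat (A * A ^\<^sub>m k)"
    using mult_pow_mat_commute[OF A one_carrier_mat, of k] A by simp
  also have "\<dots> = transpose_mat (A ^\<^sub>m k) * transpose_mat A"
    by (rule transpose_mult[OF A pow_carrier_mat[OF A]])
  finally show ?case using Suc by simp
qed

text \<open>Transposition commutes with powers and keeps the diagonal. It enters because the state
  of \<open>E\<close> is the transpose of \<open>mat_adjoint A * A\<close>.\<close>

lemma entropy_transpose:
  assumes A: "A \<in> carrier_mat n n" "mat_adjoint A = A"
  shows "entropy (transpose_mat A) = entropy A"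
proof (rule entropy_cong_power_traces)
  show "mat_adjoint (transpose_mat A) = transpose_mat A"
  proof (rule eq_matI)
    fix i j assume "i < dim_row (transpose_mat A)" "j < dim_col (transpose_mat A)"
    then show "mat_adjoint (transpose_mat A) $$ (i, j) = transpose_mat A $$ (i, j)"
      using arg_cong[OF A(2), of "\<lambda>M. M $$ (j, i)"] A(1) by simp
  qed (use A in auto)
  show "mtrace (transpose_mat A ^\<^sub>m k) = mtrace (A ^\<^sub>m k)" for k
    using A(1) by (simp add: transpose_pow_mat mtrace_def)
qed (use A in auto)

section \<open>Purifications and the state after the measurement\<close>

lemma sum_lessThan_mult:
  fixes f :: "nat \<Rightarrow> 'a :: comm_monoid_add"
  assumes "d > 0"
  shows "(\<Sum>i<n * d. f i) = (\<Sum>q<n. \<Sum>e<d. f (q * d + e))"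
proof (induction n)
  case (Suc n)
  have "(\<Sum>i<Suc n * d. f i) = (\<Sum>i<n * d. f i) + (\<Sum>e<d. f (e + n * d))"
    using sum.nat_group[of f d "Suc n"] sum.nat_group[of f d n]
    by (simp add: sum.shift_bounds_nat_ivl[of f 0 "n * d" d, simplified] add.commute atLeast0LessThan)
  then show ?case using Suc by (simp add: add.commute)
qed simp

text \<open>The matrix \<open>B\<close> below has the columns \<open>|i\<rangle> \<otimes> \<langle>i|\<psi>\<rangle>\<close>.\<close>

lemma cond_entropy_measured_state:
  assumes \<rho>: "\<rho> \<in> carrier_mat n n" and pur: "purification n d \<psi> \<rho>"
  shows "cond_entropy n d (measured_state n d \<psi>) = coherence \<rho>"
proof -
  \<comment> \<open>The ket reshaped with rows indexed by \<open>Q\<close> and columns by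
    \<open>E\<close>, so that partial traces become matrix products.\<close>
  define A where "A = mat n d (\<lambda>(q, e). \<psi> $$ (q * d + e, 0))"
  define B where "B = mat (n * d) n (\<lambda>(r, i). if r div d = i then \<psi> $$ (r, 0) else 0)"
  have A: "A \<in> carrier_mat n d" and B: "B \<in> carrier_mat (n * d) n"
    by (simp_all add: A_def B_def)
  have \<psi>: "\<psi> \<in> carrier_mat (n * d) 1" and \<rho>_eq: "ptrace_E n d (outer \<psi>) = \<rho>"
    using pur by (auto simp: purification_def)
  have idx: "q * d + e < n * d" if "q < n" "e < d" for q e
  proof -
    have "q * d + e < Suc q * d" using that by simp
    also have "\<dots> \<le> n * d" using that by (intro mult_le_mono1) simp
    finally show ?thesis .
  qed
  have Bidx: "B $$ (q * d + e, i) = (if q = i then A $$ (q, e) else 0)" if "q < n" "e < d" "i < n" for q e i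
    using idx[OF that(1,2)] that by (simp add: A_def B_def)
  have outer: "outer \<psi> $$ (r, c) = \<psi> $$ (r, 0) * cnj (\<psi> $$ (c, 0))" if "r < n * d" "c < n * d" for r c
    unfolding outer_def using \<psi> that
    by (subst index_mult_mat_sum[of _ "n * d" 1 _ "n * d"]) auto
  have \<rho>A: "\<rho> = A * mat_adjoint A"
  proof (rule eq_matI)
    fix i j assume "i < dim_row (A * mat_adjoint A)" "j < dim_col (A * mat_adjoint A)"
    then have ij: "i < n" "j < n" using A by auto
    show "\<rho> $$ (i, j) = (A * mat_adjoint A) $$ (i, j)"
      unfolding \<rho>_eq[symmetric] ptrace_E_def
      using ij A by (subst index_mult_mat_sum[of _ n d _ n]) (auto simp: outer idx A_def)
  qed (use \<rho> A in auto)
  \<comment> \<open>Contracting \<open>Q\<close> with the \<open>i\<close>-th basis vector leaves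
    row \<open>i\<close> of \<open>A\<close>.\<close>
  have proj: "(kron (mat_adjoint (ket n i)) (1\<^sub>m d) * \<psi>) $$ (e, 0) = \<psi> $$ (i * d + e, 0)"
    if "i < n" "e < d" for i e
  proof -
    let ?K = "kron (mat_adjoint (ket n i)) (1\<^sub>m d) :: complex mat"
    have K: "?K \<in> carrier_mat d (n * d)" by (rule carrier_matI) (auto simp: kron_def ket_def)
    have "(?K * \<psi>) $$ (e, 0) = (\<Sum>l<n * d. ?K $$ (e, l) * \<psi> $$ (l, 0))"
      using that by (intro index_mult_mat_sum[OF K \<psi>]) auto
    also have "\<dots> = (\<Sum>l<n * d. if l = i * d + e then \<psi> $$ (l, 0) else 0)"
    proof (rule sum.cong)
      fix l assume "l \<in> {..<n * d}"
      then have l: "l < n * d" "l div d < n" "l mod d < d" using that by (auto simp: less_mult_imp_div_less)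
      have "?K $$ (e, l) = (if l div d = i \<and> l mod d = e then 1 else 0)"
        using that l by (auto simp: kron_def ket_def)
      moreover have "l div d = i \<and> l mod d = e \<longleftrightarrow> l = i * d + e"
        using that by auto
      ultimately show "?K $$ (e, l) * \<psi> $$ (l, 0) = (if l = i * d + e then \<psi> $$ (l, 0) else 0)"
        by simp
    qed simp
    finally show ?thesis using idx[OF that] by simp
  qed
  have meas: "measured_state n d \<psi> = B * mat_adjoint B"
  proof (rule eq_matI)
    fix r c assume "r < dim_row (B * mat_adjoint B)" "c < dim_col (B * mat_adjoint B)"
    then have rc: "r < n * d" "c < n * d" using B by auto
    then have d: "d > 0" by (cases d) auto
    have dv: "r div d < n" "c div d < n" "r mod d < d" "c mod d < d"
      using rc d by (auto simp: less_mult_imp_div_less)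
    have "kron (outer (ket n i)) (outer (kron (mat_adjoint (ket n i)) (1\<^sub>m d) * \<psi>)) $$ (r, c) =
        B $$ (r, i) * mat_adjoint B $$ (i, c)" if "i < n" for i
    proof -
      let ?v = "kron (mat_adjoint (ket n i)) (1\<^sub>m d) * \<psi>"
      have K: "kron (mat_adjoint (ket n i)) (1\<^sub>m d) \<in> carrier_mat d (n * d)"
        by (rule carrier_matI) (auto simp: kron_def ket_def)
      have v: "?v \<in> carrier_mat d 1" by (rule mult_carrier_mat[OF K \<psi>])
      have ov: "outer ?v \<in> carrier_mat d d" using v by (auto simp: outer_def)
      have ok: "outer (ket n i) \<in> carrier_mat n n" by (auto simp: outer_def ket_def)
      have "outer (ket n i) $$ (r div d, c div d) = (if r div d = i \<and> c div d = i then 1 else 0)"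
        unfolding outer_def using dv
        by (subst index_mult_mat_sum[of _ n 1 _ n]) (auto simp: ket_def)
      moreover have "mat_adjoint ?v $$ (0, c mod d) = cnj (?v $$ (c mod d, 0))"
        by (rule index_mat_adjoint) (use carrier_matD[OF v] dv in linarith)+
      then have "outer ?v $$ (r mod d, c mod d) = \<psi> $$ (i * d + r mod d, 0) * cnj (\<psi> $$ (i * d + c mod d, 0))"
        unfolding outer_def using dv v that
        by (subst index_mult_mat_sum[of _ d 1 _ d]) (simp_all add: proj del: index_mult_mat(1) index_mat_adjoint)
      moreover have "kron (outer (ket n i)) (outer ?v) $$ (r, c) =
          outer (ket n i) $$ (r div d, c div d) * outer ?v $$ (r mod d, c mod d)"
        using carrier_matD[OF ov] carrier_matD[OF ok] rc unfolding kron_def by simp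
      moreover have "i * d + r mod d = r" if "r div d = i" using that by auto
      moreover have "i * d + c mod d = c" if "c div d = i" using that by auto
      ultimately show ?thesis using rc that B by (auto simp: B_def)
    qed
    then show "measured_state n d \<psi> $$ (r, c) = (B * mat_adjoint B) $$ (r, c)"
      using rc B by (subst index_mult_mat_sum[of _ "n * d" n _ "n * d"]) (auto simp: measured_state_def)
  qed (use B in \<open>auto simp: measured_state_def\<close>)
  have diag: "mat_adjoint B * B = diag_part \<rho>"
  proof (rule eq_matI)
    fix i j assume "i < dim_row (diag_part \<rho>)" "j < dim_col (diag_part \<rho>)"
    then have ij: "i < n" "j < n" using \<rho> by (auto simp: diag_part_def mat_diag_def)
    have "(mat_adjoint B * B) $$ (i, j) = (\<Sum>r<n * d. cnj (B $$ (r, i)) * B $$ (r, j))"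
      using ij B by (subst index_mult_mat_sum[of _ n "n * d" _ n]) auto
    also have "\<dots> = (\<Sum>q<n. \<Sum>e<d. cnj (B $$ (q * d + e, i)) * B $$ (q * d + e, j))"
      \<comment> \<open>For \<open>d = 0\<close> both sides are empty sums;
        \<open>sum_lessThan_mult\<close> covers \<open>d > 0\<close>.\<close>
      by (cases "d = 0") (simp_all add: sum_lessThan_mult)
    also have "\<dots> = (\<Sum>q<n. if q = i then if i = j then (\<Sum>e<d. A $$ (i, e) * cnj (A $$ (i, e))) else 0 else 0)"
      using ij by (intro sum.cong) (auto simp: Bidx mult.commute intro!: sum.cong sum.neutral)
    also have "\<dots> = (if i = j then \<rho> $$ (i, i) else 0)"
      using ij A unfolding \<rho>A by (subst index_mult_mat_sum[of _ n d _ n]) auto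
    finally show "(mat_adjoint B * B) $$ (i, j) = diag_part \<rho> $$ (i, j)"
      using ij \<rho> by (auto simp: diag_part_def mat_diag_def)
  qed (use \<rho> B in \<open>auto simp: diag_part_def mat_diag_def\<close>)
  have ptrace: "ptrace_Q n d (measured_state n d \<psi>) = transpose_mat (mat_adjoint A * A)"
  proof (rule eq_matI)
    fix e e' assume "e < dim_row (transpose_mat (mat_adjoint A * A))" "e' < dim_col (transpose_mat (mat_adjoint A * A))"
    then have ee: "e < d" "e' < d" using A by auto
    have "ptrace_Q n d (measured_state n d \<psi>) $$ (e, e') =
        (\<Sum>q<n. \<Sum>i<n. B $$ (q * d + e, i) * cnj (B $$ (q * d + e', i)))"
      unfolding meas ptrace_Q_def using ee B idx
      by (auto simp: index_mult_mat_sum[of _ "n * d" n _ "n * d"] simp del: index_mult_mat(1) intro!: sum.cong)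
    also have "\<dots> = (\<Sum>q<n. \<Sum>i<n. if i = q then A $$ (q, e) * cnj (A $$ (q, e')) else 0)"
      using ee by (intro sum.cong) (auto simp: Bidx)
    also have "\<dots> = (\<Sum>q<n. cnj (A $$ (q, e')) * A $$ (q, e))"
      by (simp add: mult.commute)
    also have "\<dots> = (mat_adjoint A * A) $$ (e', e)"
      using ee A by (subst index_mult_mat_sum[of _ d n _ d]) auto
    finally show "ptrace_Q n d (measured_state n d \<psi>) $$ (e, e') = transpose_mat (mat_adjoint A * A) $$ (e, e')"
      using ee A by simp
  qed (use A in \<open>auto simp: ptrace_Q_def\<close>)
  have "entropy (transpose_mat (mat_adjoint A * A)) = entropy (mat_adjoint A * A)"
    using A by (intro entropy_transpose) (auto simp: mat_adjoint_mult[of _ d n _ d])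
  then show ?thesis
    unfolding cond_entropy_def coherence_def ptrace
    unfolding meas entropy_mult_adjoint_commute[OF B] diag
    by (simp add: \<rho>A entropy_mult_adjoint_commute[OF A])
qed

text \<open>The canonical purification: eigenvector \<open>e\<close> of \<rho>, weighted by the root
  of its eigenvalue, is paired with basis vector \<open>e\<close> of a copy of
  \<open>Q\<close>.\<close>

lemma purification_exists:
  assumes \<rho>: "\<rho> \<in> carrier_mat n n" "mat_adjoint \<rho> = \<rho>"
    and psd: "\<And>v. v \<in> carrier_vec n \<Longrightarrow> 0 \<le> Re ((\<rho> *\<^sub>v v) \<bullet>c v)"
  shows "\<exists>\<psi>. purification n n \<psi> \<rho>"
proof -
  obtain U d where Ud: "spectral_decomp \<rho> U d"
    using hermitian_spectral_decomp[OF \<rho>] by blast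
  define D where "D = mat_diag n (\<lambda>i. complex_of_real (d i))"
  have U: "U \<in> carrier_mat n n" "mat_adjoint U * U = 1\<^sub>m n" "\<rho> = U * D * mat_adjoint U"
    using Ud \<rho>(1) unfolding spectral_decomp_def Let_def D_def by simp_all
  have D: "D \<in> carrier_mat n n" by (simp add: D_def)
  \<comment> \<open>The quadratic form at the unit eigenvector \<open>col U j\<close> equals the
    eigenvalue \<open>d j\<close>.\<close>
  have d: "d j \<ge> 0" if j: "j < n" for j
  proof -
    have "\<rho> * U = U * D * (mat_adjoint U * U)"
      unfolding U(3) using U(1) D by (simp add: assoc_mult_mat[of _ n n _ n _ n])
    then have "\<rho> * U = U * D" unfolding U(2) using U(1) D by simp
    then have "col (\<rho> * U) j = complex_of_real (d j) \<cdot>\<^sub>v col U j"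
      unfolding D_def using j U(1) by (auto simp: mat_diag_mult_right[OF U(1)] simp del: col_mult2)
    then have "\<rho> *\<^sub>v col U j = complex_of_real (d j) \<cdot>\<^sub>v col U j"
      using col_mult2[OF \<rho>(1) U(1) j] by simp
    moreover have "col U j \<bullet>c col U j = (mat_adjoint U * U) $$ (j, j)"
      using U(1) j by (simp add: scalar_prod_def mult.commute)
    ultimately have "(\<rho> *\<^sub>v col U j) \<bullet>c col U j = complex_of_real (d j)"
      using U(2) j by simp
    then show ?thesis using psd[of "col U j"] U(1) j by simp
  qed
  define \<psi> where "\<psi> = mat (n * n) 1 (\<lambda>(r, c). U $$ (r div n, r mod n) * complex_of_real (sqrt (d (r mod n))))"
  have idx: "q * n + e < n * n" if "q < n" "e < n" for q e
  proof -
    have "q * n + e < Suc q * n" using that by simp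
    also have "\<dots> \<le> n * n" using that by (intro mult_le_mono1) simp
    finally show ?thesis .
  qed
  have outer: "outer \<psi> $$ (r, c) = \<psi> $$ (r, 0) * cnj (\<psi> $$ (c, 0))" if "r < n * n" "c < n * n" for r c
    unfolding outer_def using that
    by (subst index_mult_mat_sum[of _ "n * n" 1 _ "n * n"]) (auto simp: \<psi>_def)
  have "ptrace_E n n (outer \<psi>) = \<rho>"
  proof (rule eq_matI)
    fix i j assume "i < dim_row \<rho>" "j < dim_col \<rho>"
    then have ij: "i < n" "j < n" using \<rho>(1) by auto
    have "ptrace_E n n (outer \<psi>) $$ (i, j) = (\<Sum>e<n. \<psi> $$ (i * n + e, 0) * cnj (\<psi> $$ (j * n + e, 0)))"
      using ij by (auto simp: ptrace_E_def outer idx)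
    also have "\<dots> = (\<Sum>e<n. U $$ (i, e) * complex_of_real (d e) * cnj (U $$ (j, e)))"
    proof (rule sum.cong)
      fix e assume "e \<in> {..<n}"
      then have e: "e < n" by simp
      have "complex_of_real (sqrt (d e)) * complex_of_real (sqrt (d e)) = complex_of_real (d e)"
        using d[OF e] by (simp flip: of_real_mult)
      then show "\<psi> $$ (i * n + e, 0) * cnj (\<psi> $$ (j * n + e, 0)) = U $$ (i, e) * complex_of_real (d e) * cnj (U $$ (j, e))"
        using ij e by (simp add: \<psi>_def idx mult_ac)
    qed simp
    also have "\<dots> = \<rho> $$ (i, j)"
      unfolding U(3) using ij U(1) D
      by (subst index_mult_mat_sum[of _ n n _ n])
        (auto simp: D_def mat_diag_mult_right[OF U(1)])
    finally show "ptrace_E n n (outer \<psi>) $$ (i, j) = \<rho> $$ (i, j)" .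
  qed (use \<rho> in \<open>auto simp: ptrace_E_def\<close>)
  moreover have "\<psi> \<in> carrier_mat (n * n) 1" by (simp add: \<psi>_def)
  ultimately show ?thesis by (auto simp: purification_def)
qed

text \<open>The definite description denotes, since some purification exists and every purification,
  whatever the dimension of \<open>E\<close>, gives the coherence.\<close>

theorem intrinsic_randomness_eq_coherence:
  assumes \<rho>: "\<rho> \<in> carrier_mat n n" "mat_adjoint \<rho> = \<rho>"
    and psd: "\<And>v. v \<in> carrier_vec n \<Longrightarrow> 0 \<le> Re ((\<rho> *\<^sub>v v) \<bullet>c v)"
  shows "intrinsic_randomness \<rho> = coherence \<rho>"
proof -
  have dim: "dim_row \<rho> = n" using \<rho>(1) by simp
  show ?thesis
    unfolding intrinsic_randomness_def dim
    using purification_exists[OF assms] cond_entropy_measured_state[OF \<rho>(1)]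
    by (intro the_equality) metis+
qed

section \<open>Two-qubit states in X form\<close>

lemma less_4_cases: "(i :: nat) < 4 \<longleftrightarrow> i = 0 \<or> i = 1 \<or> i = 2 \<or> i = 3"
  by auto

lemma sum_lessThan_4: "(\<Sum>i<4. f i) = f 0 + f 1 + f 2 + f (3 :: nat)"
  by (simp add: eval_nat_numeral)

lemma index_mult_mat_4:
  assumes "A \<in> carrier_mat 4 4" "B \<in> carrier_mat 4 4" "i < 4" "j < 4"
  shows "(A * B) $$ (i, j) = A $$ (i, 0) * B $$ (0, j) + A $$ (i, 1) * B $$ (1, j) +
    A $$ (i, 2) * B $$ (2, j) + A $$ (i, 3) * B $$ (3, j)"
  by (simp only: index_mult_mat_sum[OF assms] sum_lessThan_4)

lemma cscalar_prod_4:
  fixes A :: "complex mat"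
  assumes "A \<in> carrier_mat 4 4" "v \<in> carrier_vec 4"
  shows "(A *\<^sub>v v) \<bullet>c v = (\<Sum>i<4. (\<Sum>j<4. A $$ (i, j) * v $ j) * cnj (v $ i))"
  using assms by (auto simp: scalar_prod_def atLeast0LessThan intro!: sum.cong)

text \<open>In the reordered basis 00, 11, 01, 10 this is a direct sum of two Hermitian blocks: an
  outer one with diagonal \<open>p\<close>, \<open>s\<close> and an inner one with diagonal
  \<open>q\<close>, \<open>r\<close>.\<close>

definition x_mat :: "real \<Rightarrow> real \<Rightarrow> real \<Rightarrow> real \<Rightarrow> complex \<Rightarrow> complex \<Rightarrow> complex mat" where
  "x_mat p q r s a b = mat_of_rows_list 4
     [[of_real p, 0, 0, a], [0, of_real q, b, 0], [0, cnj b, of_real r, 0], [cnj a, 0, 0, of_real s]]"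

lemma x_mat_carrier [simp]: "x_mat p q r s a b \<in> carrier_mat 4 4"
  by (rule carrier_matI) (simp_all add: x_mat_def mat_of_rows_list_def)

lemma dim_x_mat [simp]: "dim_row (x_mat p q r s a b) = 4" "dim_col (x_mat p q r s a b) = 4"
  by (simp_all add: x_mat_def mat_of_rows_list_def)

lemma index_x_mat [simp]:
  "x_mat p q r s a b $$ (0, 0) = of_real p" "x_mat p q r s a b $$ (0, 1) = 0"
  "x_mat p q r s a b $$ (0, Suc 0) = 0" "x_mat p q r s a b $$ (0, 2) = 0" "x_mat p q r s a b $$ (0, 3) = a"
  "x_mat p q r s a b $$ (1, 0) = 0" "x_mat p q r s a b $$ (1, 1) = of_real q"
  "x_mat p q r s a b $$ (Suc 0, 0) = 0" "x_mat p q r s a b $$ (Suc 0, Suc 0) = of_real q"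
  "x_mat p q r s a b $$ (1, 2) = b" "x_mat p q r s a b $$ (1, 3) = 0"
  "x_mat p q r s a b $$ (Suc 0, 2) = b" "x_mat p q r s a b $$ (Suc 0, 3) = 0"
  "x_mat p q r s a b $$ (2, 0) = 0" "x_mat p q r s a b $$ (2, 1) = cnj b"
  "x_mat p q r s a b $$ (2, Suc 0) = cnj b" "x_mat p q r s a b $$ (2, 2) = of_real r" "x_mat p q r s a b $$ (2, 3) = 0"
  "x_mat p q r s a b $$ (3, 0) = cnj a" "x_mat p q r s a b $$ (3, 1) = 0"
  "x_mat p q r s a b $$ (3, Suc 0) = 0" "x_mat p q r s a b $$ (3, 2) = 0" "x_mat p q r s a b $$ (3, 3) = of_real s"
  by (simp_all add: x_mat_def mat_of_rows_list_def numeral_2_eq_2 numeral_3_eq_3)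

lemma mat_adjoint_x_mat: "mat_adjoint (x_mat p q r s a b) = x_mat p q r s a b"
  by (rule eq_matI) (auto simp: less_4_cases)

lemma diag_part_x_mat: "diag_part (x_mat p q r s a b) = x_mat p q r s 0 0"
  by (rule eq_matI) (auto simp: less_4_cases diag_part_def mat_diag_def)

lemma mtrace_x_mat: "mtrace (x_mat p q r s a b) = complex_of_real (p + q + r + s)"
  by (simp add: mtrace_def sum_lessThan_4)

text \<open>For \<epsilon> equal to \<open>1\<close> and \<open>-1\<close>, the eigenvalues of a
  Hermitian block with diagonal \<open>x\<close>, \<open>y\<close> and off-diagonal modulus
  \<open>t\<close>.\<close>

definition block_ev :: "real \<Rightarrow> real \<Rightarrow> real \<Rightarrow> real \<Rightarrow> real" where
  "block_ev \<epsilon> x y t = (x + y + \<epsilon> * sqrt ((x - y)\<^sup>2 + 4 * t\<^sup>2)) / 2"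

text \<open>The characteristic equation of the block, with trace \<open>x + y\<close> and
  determinant \<open>x * y - t\<^sup>2\<close>.\<close>

lemma block_ev_char_eq:
  assumes "\<epsilon>\<^sup>2 = 1"
  shows "(block_ev \<epsilon> x y t)\<^sup>2 = (x + y) * block_ev \<epsilon> x y t - (x * y - t\<^sup>2)"
proof -
  define w where "w = sqrt ((x - y)\<^sup>2 + 4 * t\<^sup>2)"
  have "w\<^sup>2 = (x - y)\<^sup>2 + 4 * t\<^sup>2" by (simp add: w_def)
  then have w: "(\<epsilon> * w)\<^sup>2 = (x - y)\<^sup>2 + 4 * t\<^sup>2" using assms by (simp add: power_mult_distrib)
  have e: "block_ev \<epsilon> x y t = (x + y + \<epsilon> * w) / 2" by (simp add: block_ev_def w_def)
  have "4 * ((block_ev \<epsilon> x y t)\<^sup>2 - (x + y) * block_ev \<epsilon> x y t) = (\<epsilon> * w)\<^sup>2 - (x + y)\<^sup>2"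
    unfolding e by (simp add: power2_eq_square field_simps)
  then show ?thesis unfolding w by (simp add: power2_eq_square algebra_simps)
qed

lemma block_ev_sum: "block_ev 1 x y t + block_ev (-1) x y t = x + y"
  by (simp add: block_ev_def field_simps)

text \<open>By Cayley-Hamilton each of the two blocks \<open>M\<close> satisfies \<open>M ^ k = u M + v\<close> for the same
  reals \<open>u\<close>, \<open>v\<close> as its eigenvalues.\<close>

lemma pow_x_mat:
  "\<exists>u v u' v'. x_mat p q r s a b ^\<^sub>m k =
      x_mat (u * p + v) (u' * q + v') (u' * r + v') (u * s + v) (of_real u * a) (of_real u' * b) \<and>
    (\<forall>\<epsilon>. \<epsilon>\<^sup>2 = 1 \<longrightarrow> block_ev \<epsilon> p s (cmod a) ^ k = u * block_ev \<epsilon> p s (cmod a) + v) \<and>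
    (\<forall>\<epsilon>. \<epsilon>\<^sup>2 = 1 \<longrightarrow> block_ev \<epsilon> q r (cmod b) ^ k = u' * block_ev \<epsilon> q r (cmod b) + v')"
proof (induction k)
  case 0
  have "1\<^sub>m 4 = x_mat 1 1 1 1 0 0" by (rule eq_matI) (auto simp: less_4_cases)
  then show ?case by (intro exI[of _ 0] exI[of _ 1]) simp
next
  case (Suc k)
  then obtain u v u' v' where IH: "x_mat p q r s a b ^\<^sub>m k =
      x_mat (u * p + v) (u' * q + v') (u' * r + v') (u * s + v) (of_real u * a) (of_real u' * b)"
    "\<And>\<epsilon>. \<epsilon>\<^sup>2 = 1 \<Longrightarrow> block_ev \<epsilon> p s (cmod a) ^ k = u * block_ev \<epsilon> p s (cmod a) + v"
    "\<And>\<epsilon>. \<epsilon>\<^sup>2 = 1 \<Longrightarrow> block_ev \<epsilon> q r (cmod b) ^ k = u' * block_ev \<epsilon> q r (cmod b) + v'"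
    by blast
  \<comment> \<open>The coefficients of \<open>x * (u * x + v)\<close> reduced modulo the
    characteristic polynomial of the outer block; \<open>U'\<close> and \<open>V'\<close> do the
    same for the inner one.\<close>
  define U V where "U = u * (p + s) + v" and "V = - u * (p * s - (cmod a)\<^sup>2)"
  define U' V' where "U' = u' * (q + r) + v'" and "V' = - u' * (q * r - (cmod b)\<^sup>2)"
  have step: "x * (c * x + e) = (c * t + e) * x - c * \<delta>" if "x\<^sup>2 = t * x - \<delta>" for x c e t \<delta> :: real
  proof -
    have "x * (c * x + e) = c * x\<^sup>2 + e * x" by (simp add: power2_eq_square algebra_simps)
    then show ?thesis unfolding that by (simp add: algebra_simps)
  qed
  have "block_ev \<epsilon> p s (cmod a) ^ Suc k = U * block_ev \<epsilon> p s (cmod a) + V" if "\<epsilon>\<^sup>2 = 1" for \<epsilon>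
    using step[OF block_ev_char_eq[OF that, of p s "cmod a"], of u v] by (simp add: IH(2)[OF that] U_def V_def)
  moreover have "block_ev \<epsilon> q r (cmod b) ^ Suc k = U' * block_ev \<epsilon> q r (cmod b) + V'" if "\<epsilon>\<^sup>2 = 1" for \<epsilon>
    using step[OF block_ev_char_eq[OF that, of q r "cmod b"], of u' v'] by (simp add: IH(3)[OF that] U'_def V'_def)
  moreover have "x_mat p q r s a b ^\<^sub>m Suc k =
      x_mat (U * p + V) (U' * q + V') (U' * r + V') (U * s + V) (of_real U * a) (of_real U' * b)"
  proof -
    have sq: "(complex_of_real (cmod z))\<^sup>2 = z * cnj z" for z
      by (simp add: complex_norm_square flip: of_real_power)
    show ?thesis
      unfolding pow_mat.simps IH(1)
    proof (rule eq_matI)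
      fix i j
      assume "i < dim_row (x_mat (U * p + V) (U' * q + V') (U' * r + V') (U * s + V) (of_real U * a) (of_real U' * b))"
        "j < dim_col (x_mat (U * p + V) (U' * q + V') (U' * r + V') (U * s + V) (of_real U * a) (of_real U' * b))"
      then have ij: "i < 4" "j < 4" by auto
      then show "(x_mat (u * p + v) (u' * q + v') (u' * r + v') (u * s + v) (of_real u * a) (of_real u' * b) *
          x_mat p q r s a b) $$ (i, j) =
        x_mat (U * p + V) (U' * q + V') (U' * r + V') (U * s + V) (of_real U * a) (of_real U' * b) $$ (i, j)"
        unfolding index_mult_mat_4[OF x_mat_carrier x_mat_carrier ij] less_4_cases
        by (elim disjE) (simp_all add: U_def V_def U'_def V'_def sq algebra_simps)
    qed simp_all
  qed
  ultimately show ?case by blast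
qed

definition block_neg_entropy :: "real \<Rightarrow> real \<Rightarrow> real \<Rightarrow> real" where
  "block_neg_entropy x y t = xlog (block_ev 1 x y t) + xlog (block_ev (-1) x y t)"

text \<open>Each block contributes \<open>u\<close> times its trace plus \<open>2 * v\<close> to the
  power trace, which by \<open>block_ev_sum\<close> is the power sum of its two eigenvalues.\<close>

lemma entropy_x_mat:
  "entropy (x_mat p q r s a b) = - (block_neg_entropy p s (cmod a) + block_neg_entropy q r (cmod b))"
proof -
  define l where "l i = [block_ev 1 p s (cmod a), block_ev (-1) p s (cmod a),
    block_ev 1 q r (cmod b), block_ev (-1) q r (cmod b)] ! i" for i
  have l: "l 0 = block_ev 1 p s (cmod a)" "l 1 = block_ev (-1) p s (cmod a)"
    "l 2 = block_ev 1 q r (cmod b)" "l 3 = block_ev (-1) q r (cmod b)"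
    by (simp_all add: l_def)
  have "mtrace (x_mat p q r s a b ^\<^sub>m k) = (\<Sum>i<4. complex_of_real (l i ^ k))" for k
  proof -
    obtain u v u' v' where pw: "x_mat p q r s a b ^\<^sub>m k =
        x_mat (u * p + v) (u' * q + v') (u' * r + v') (u * s + v) (of_real u * a) (of_real u' * b)"
      "\<And>\<epsilon>. \<epsilon>\<^sup>2 = 1 \<Longrightarrow> block_ev \<epsilon> p s (cmod a) ^ k = u * block_ev \<epsilon> p s (cmod a) + v"
      "\<And>\<epsilon>. \<epsilon>\<^sup>2 = 1 \<Longrightarrow> block_ev \<epsilon> q r (cmod b) ^ k = u' * block_ev \<epsilon> q r (cmod b) + v'"
      using pow_x_mat[of p q r s a b k] by blast
    have "(\<Sum>i<4. l i ^ k) = u * (block_ev 1 p s (cmod a) + block_ev (-1) p s (cmod a)) + 2 * v +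
        (u' * (block_ev 1 q r (cmod b) + block_ev (-1) q r (cmod b)) + 2 * v')"
      unfolding sum_lessThan_4 l by (simp add: pw(2,3) algebra_simps)
    also have "\<dots> = (u * p + v) + (u' * q + v') + (u' * r + v') + (u * s + v)"
      unfolding block_ev_sum by (simp add: algebra_simps)
    finally show ?thesis
      unfolding pw(1) mtrace_x_mat of_real_sum[symmetric] by (simp only:)
  qed
  then have "entropy (x_mat p q r s a b) = - (\<Sum>i<4. xlog (l i))"
    by (intro entropy_eq_of_power_traces[OF x_mat_carrier mat_adjoint_x_mat]) auto
  then show ?thesis
    unfolding sum_lessThan_4 l by (simp add: block_neg_entropy_def)
qed

text \<open>The value at \<open>t = 0\<close> belongs to the diagonal part, so this is the coherence
  of a single block, whose trace may differ from one.\<close>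

definition block_coherence :: "real \<Rightarrow> real \<Rightarrow> real \<Rightarrow> real" where
  "block_coherence x y t = block_neg_entropy x y t - block_neg_entropy x y 0"

lemma coherence_x_mat:
  "coherence (x_mat p q r s a b) = block_coherence p s (cmod a) + block_coherence q r (cmod b)"
  by (simp add: coherence_def diag_part_x_mat entropy_x_mat block_coherence_def)

lemma block_coherence_0 [simp]: "block_coherence x y 0 = 0"
  by (simp add: block_coherence_def)

lemma xlog_mult: "0 < c \<Longrightarrow> 0 \<le> x \<Longrightarrow> xlog (c * x) = c * xlog x + log 2 c * c * x"
  by (cases "x = 0") (auto simp: xlog_def log_mult algebra_simps)

text \<open>The radicand is \<open>(x + y)\<^sup>2\<close> minus four times the determinant, and the
  determinant is nonnegative.\<close>

lemma block_ev_nonneg: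
  assumes "0 \<le> x" "0 \<le> y" "t\<^sup>2 \<le> x * y" "\<epsilon> = 1 \<or> \<epsilon> = -1"
  shows "0 \<le> block_ev \<epsilon> x y t"
proof -
  have "sqrt ((x - y)\<^sup>2 + 4 * t\<^sup>2) \<le> sqrt ((x + y)\<^sup>2)"
    using assms(3) by (intro real_sqrt_le_mono) (simp add: power2_eq_square algebra_simps)
  then have "sqrt ((x - y)\<^sup>2 + 4 * t\<^sup>2) \<le> x + y" using assms(1,2) by simp
  then show ?thesis using assms(1,2,4) by (auto simp: block_ev_def)
qed

lemma block_ev_mult:
  assumes "0 < c"
  shows "block_ev \<epsilon> (c * x) (c * y) (c * t) = c * block_ev \<epsilon> x y t"
proof -
  have "(c * x - c * y)\<^sup>2 + 4 * (c * t)\<^sup>2 = c\<^sup>2 * ((x - y)\<^sup>2 + 4 * t\<^sup>2)"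
    by (simp add: power2_eq_square algebra_simps)
  then have "sqrt ((c * x - c * y)\<^sup>2 + 4 * (c * t)\<^sup>2) = c * sqrt ((x - y)\<^sup>2 + 4 * t\<^sup>2)"
    using assms by (simp add: real_sqrt_mult)
  then show ?thesis by (simp add: block_ev_def algebra_simps)
qed

lemma block_neg_entropy_mult:
  assumes "0 < c" "0 \<le> x" "0 \<le> y" "t\<^sup>2 \<le> x * y"
  shows "block_neg_entropy (c * x) (c * y) (c * t) = c * block_neg_entropy x y t + log 2 c * c * (x + y)"
proof -
  have "block_neg_entropy (c * x) (c * y) (c * t) =
      c * block_neg_entropy x y t + log 2 c * c * (block_ev 1 x y t + block_ev (-1) x y t)"
    using assms block_ev_nonneg[OF assms(2-4)]
    by (simp add: block_neg_entropy_def block_ev_mult xlog_mult distrib_left)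
  then show ?thesis by (simp only: block_ev_sum)
qed

text \<open>The logarithmic term in \<open>block_neg_entropy_mult\<close> involves only the trace
  \<open>x + y\<close>, not \<open>t\<close>, and cancels. Homogeneity absorbs the weights of the
  conditional states into unnormalised blocks.\<close>

lemma block_coherence_mult:
  assumes "0 < c" "0 \<le> x" "0 \<le> y" "t\<^sup>2 \<le> x * y"
  shows "block_coherence (c * x) (c * y) (c * t) = c * block_coherence x y t"
  using block_neg_entropy_mult[OF assms] block_neg_entropy_mult[OF assms(1-3), of 0] assms(2,3)
  by (simp add: block_coherence_def right_diff_distrib)

text \<open>The slope is the derivative of \<open>xlog\<close> at \<open>z\<close>; for
  \<open>x > 0\<close> the bound is \<open>ln u \<le> u - 1\<close> at
  \<open>u = z / x\<close>.\<close>

lemma xlog_ge_tangent: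
  assumes "0 < z" "0 \<le> x"
  shows "xlog z + (log 2 z + 1 / ln 2) * (x - z) \<le> xlog x"
proof (cases "x = 0")
  case True
  then show ?thesis using assms by (simp add: xlog_def algebra_simps)
next
  case False
  then have x: "0 < x" using assms by simp
  have "x * ln (z / x) \<le> x * (z / x - 1)"
    using x assms by (intro mult_left_mono ln_le_minus_one) auto
  then have "x * (ln z - ln x) \<le> z - x"
    using x assms by (simp add: ln_div right_diff_distrib)
  then have "(x * (ln z - ln x)) / ln 2 \<le> (z - x) / ln 2"
    by (intro divide_right_mono) auto
  then show ?thesis by (simp add: xlog_def log_def field_simps)
qed

text \<open>Average the tangent bounds at the intermediate point \<open>z\<close>: the linear terms
  cancel. If \<open>z = 0\<close> there is no tangent, but then both \<open>(1 - t) * x\<close> and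
  \<open>t * y\<close> vanish.\<close>

lemma xlog_convex:
  assumes t: "0 \<le> t" "t \<le> 1" and xy: "0 \<le> x" "0 \<le> y"
  shows "xlog ((1 - t) * x + t * y) \<le> (1 - t) * xlog x + t * xlog y"
proof -
  define z where "z = (1 - t) * x + t * y"
  show ?thesis
  proof (cases "z = 0")
    case True
    then have "(1 - t) * x = 0" "t * y = 0"
      using t xy by (simp_all add: z_def add_nonneg_eq_0_iff)
    then show ?thesis by (auto simp: xlog_def)
  next
    case False
    then have z: "0 < z" using t xy by (simp add: z_def order_less_le)
    define m where "m = log 2 z + 1 / ln 2"
    have "(1 - t) * (xlog z + m * (x - z)) + t * (xlog z + m * (y - z)) \<le> (1 - t) * xlog x + t * xlog y"
      unfolding m_def using t xy z by (intro add_mono mult_left_mono xlog_ge_tangent) auto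
    moreover have "(1 - t) * (xlog z + m * (x - z)) + t * (xlog z + m * (y - z)) = xlog z"
      by (simp add: z_def algebra_simps)
    ultimately show ?thesis by (simp add: z_def)
  qed
qed

lemma xlog_spread_mono:
  assumes "0 \<le> w" "w \<le> w'" "w' \<le> s"
  shows "xlog (s + w) + xlog (s - w) \<le> xlog (s + w') + xlog (s - w')"
proof (cases "w' = 0")
  case False
  then have w': "0 < w'" using assms by simp
  \<comment> \<open>The weight that writes \<open>s + w\<close> as a convex combination of
    \<open>s - w'\<close> and \<open>s + w'\<close>; swapping the weights gives
    \<open>s - w\<close>, so the two convexity bounds add up to the claim.\<close>
  define t where "t = (w' + w) / (2 * w')"
  have t: "0 \<le> t" "t \<le> 1" using assms w' by (auto simp: t_def field_simps)
  have "t * (2 * w') = w' + w" using w' by (simp add: t_def)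
  then have eq: "s + w = (1 - t) * (s - w') + t * (s + w')"
    "s - w = (1 - t) * (s + w') + t * (s - w')"
    by (simp_all add: algebra_simps)
  have "xlog (s + w) \<le> (1 - t) * xlog (s - w') + t * xlog (s + w')"
    unfolding eq(1) by (rule xlog_convex[OF t]) (use assms in auto)
  moreover have "xlog (s - w) \<le> (1 - t) * xlog (s + w') + t * xlog (s - w')"
    unfolding eq(2) by (rule xlog_convex[OF t]) (use assms in auto)
  ultimately show ?thesis by (simp add: algebra_simps)
qed (use assms in auto)

text \<open>The eigenvalues lie symmetrically about \<open>(x + y) / 2\<close> and move apart as
  \<open>t\<close> grows. The bound on \<open>t'\<close> keeps the smaller one nonnegative, within
  the range of \<open>xlog_spread_mono\<close>.\<close>

lemma block_coherence_mono:
  assumes "0 \<le> x" "0 \<le> y" "0 \<le> t" "t \<le> t'" "t'\<^sup>2 \<le> x * y"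
  shows "block_coherence x y t \<le> block_coherence x y t'"
proof -
  define w where "w t = sqrt ((x - y)\<^sup>2 + 4 * t\<^sup>2) / 2" for t :: real
  have ev: "block_ev 1 x y t = (x + y) / 2 + w t" "block_ev (-1) x y t = (x + y) / 2 - w t" for t
    by (simp_all add: block_ev_def w_def field_simps)
  have "w t \<le> w t'"
    unfolding w_def using assms by (intro divide_right_mono real_sqrt_le_mono add_left_mono mult_left_mono power_mono) auto
  moreover have "w t' \<le> (x + y) / 2"
    using block_ev_nonneg[OF assms(1,2,5), of "-1"] ev(2)[of t'] by simp
  ultimately have "block_neg_entropy x y t \<le> block_neg_entropy x y t'"
    unfolding block_neg_entropy_def ev by (intro xlog_spread_mono) (auto simp: w_def)
  then show ?thesis by (simp add: block_coherence_def)
qed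

text \<open>The cross term is at most twice \<open>sqrt x * sqrt y * cmod v * cmod w\<close>, and a
  completed square dominates that.\<close>

lemma block_form_nonneg:
  assumes "0 \<le> x" "0 \<le> y" "(cmod a)\<^sup>2 \<le> x * y"
  shows "0 \<le> x * (cmod v)\<^sup>2 + y * (cmod w)\<^sup>2 + 2 * Re (a * w * cnj v)"
proof -
  have "cmod a \<le> sqrt x * sqrt y"
    using real_sqrt_le_mono[OF assms(3)] by (simp add: real_sqrt_mult)
  then have "cmod a * (cmod w * cmod v) \<le> (sqrt x * sqrt y) * (cmod w * cmod v)"
    by (intro mult_right_mono) auto
  moreover have "- Re (a * w * cnj v) \<le> cmod a * (cmod w * cmod v)"
    using abs_Re_le_cmod[of "a * w * cnj v"] by (simp add: norm_mult)
  moreover have "0 \<le> (sqrt x * cmod v - sqrt y * cmod w)\<^sup>2" by simp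
  then have "2 * ((sqrt x * sqrt y) * (cmod w * cmod v)) \<le> x * (cmod v)\<^sup>2 + y * (cmod w)\<^sup>2"
    using assms(1,2) by (simp add: power2_diff power_mult_distrib mult_ac)
  ultimately show ?thesis by linarith
qed

lemma x_mat_form_nonneg:
  assumes "0 \<le> p" "0 \<le> q" "0 \<le> r" "0 \<le> s" "(cmod a)\<^sup>2 \<le> p * s" "(cmod b)\<^sup>2 \<le> q * r"
    and v: "v \<in> carrier_vec 4"
  shows "0 \<le> Re ((x_mat p q r s a b *\<^sub>v v) \<bullet>c v)"
proof -
  have "Re ((x_mat p q r s a b *\<^sub>v v) \<bullet>c v) =
    (p * (cmod (v $ 0))\<^sup>2 + s * (cmod (v $ 3))\<^sup>2 + 2 * Re (a * v $ 3 * cnj (v $ 0))) +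
    (q * (cmod (v $ 1))\<^sup>2 + r * (cmod (v $ 2))\<^sup>2 + 2 * Re (b * v $ 2 * cnj (v $ 1)))"
    unfolding cscalar_prod_4[OF x_mat_carrier v] sum_lessThan_4 cmod_power2
    by (simp add: power2_eq_square algebra_simps)
  moreover note block_form_nonneg[OF assms(1,4,5), of "v $ 0" "v $ 3"]
    block_form_nonneg[OF assms(2,3,6), of "v $ 1" "v $ 2"]
  ultimately show ?thesis by linarith
qed

lemma block_form_bound:
  assumes "0 \<le> x" "0 \<le> y" and form: "\<And>v w. 0 \<le> x * (cmod v)\<^sup>2 + y * (cmod w)\<^sup>2 + 2 * Re (a * w * cnj v)"
  shows "(cmod a)\<^sup>2 \<le> x * y"
proof -
  \<comment> \<open>The form at \<open>v = - \<kappa> a\<close>, \<open>w = \<tau>\<close>, a choice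
    of phase that makes the cross term real.\<close>
  have f: "0 \<le> x * \<kappa>\<^sup>2 * (cmod a)\<^sup>2 + y * \<tau>\<^sup>2 - 2 * \<kappa> * \<tau> * (cmod a)\<^sup>2" for \<kappa> \<tau> :: real
  proof -
    have "a * of_real \<tau> * cnj (- of_real \<kappa> * a) = of_real (- \<kappa> * \<tau>) * (a * cnj a)"
      by simp
    also have "\<dots> = of_real (- \<kappa> * \<tau> * (cmod a)\<^sup>2)"
      unfolding complex_norm_square[symmetric] of_real_mult ..
    finally have "Re (a * of_real \<tau> * cnj (- of_real \<kappa> * a)) = - \<kappa> * \<tau> * (cmod a)\<^sup>2"
      by (simp only: Re_complex_of_real)
    then show ?thesis
      using form[of "- of_real \<kappa> * a" "of_real \<tau>"] by (simp add: norm_mult power_mult_distrib)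
  qed
  show ?thesis
  proof (cases "a = 0 \<or> y = 0")
    case True
    have "(cmod a)\<^sup>2 = 0" if "y = 0"
      \<comment> \<open>With \<open>y = 0\<close> these parameters leave
        \<open>- (cmod a)\<^sup>2\<close>.\<close>
      using f[of 1 "(x + 1) / 2"] that by (simp add: field_simps)
    then show ?thesis using True assms(1,2) by auto
  next
    case False
    then have "0 < y * (cmod a)\<^sup>2" using assms(2) by simp
    \<comment> \<open>The choice \<open>\<kappa> = y\<close>,
      \<open>\<tau> = (cmod a)\<^sup>2\<close> makes the form a positive multiple of the
      determinant.\<close>
    moreover have "0 \<le> y * (cmod a)\<^sup>2 * (x * y - (cmod a)\<^sup>2)"
      using f[of y "(cmod a)\<^sup>2"] by (simp add: power2_eq_square algebra_simps)
    ultimately show ?thesis by (simp add: zero_le_mult_iff)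
  qed
qed

lemma intrinsic_randomness_x_mat:
  assumes "0 \<le> p" "0 \<le> q" "0 \<le> r" "0 \<le> s" "(cmod a)\<^sup>2 \<le> p * s" "(cmod b)\<^sup>2 \<le> q * r"
  shows "intrinsic_randomness (x_mat p q r s a b) = block_coherence p s (cmod a) + block_coherence q r (cmod b)"
  using intrinsic_randomness_eq_coherence[OF x_mat_carrier mat_adjoint_x_mat x_mat_form_nonneg[OF assms]]
  by (simp add: coherence_x_mat)

section \<open>The six-state protocol\<close>

lemma index_outer_kron_qubits:
  assumes "u \<in> carrier_mat 2 1" "v \<in> carrier_mat 2 1" "i < 4" "j < 4"
  shows "outer (kron u v) $$ (i, j) =
    (u $$ (i div 2, 0) * v $$ (i mod 2, 0)) * cnj (u $$ (j div 2, 0) * v $$ (j mod 2, 0))"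
proof -
  have k: "kron u v \<in> carrier_mat 4 1"
    by (rule carrier_matI) (use assms in \<open>auto simp: kron_def\<close>)
  have "kron u v $$ (l, 0) = u $$ (l div 2, 0) * v $$ (l mod 2, 0)" if "l < 4" for l
    using assms that by (simp add: kron_def)
  then show ?thesis
    unfolding outer_def using k assms by (subst index_mult_mat_sum[of _ 4 1 _ 4]) simp_all
qed

lemma outer_kron_carrier:
  "u \<in> carrier_mat 2 1 \<Longrightarrow> v \<in> carrier_mat 2 1 \<Longrightarrow> outer (kron u v) \<in> carrier_mat 4 4"
  by (rule carrier_matI) (auto simp: outer_def kron_def)

lemma qubit_ket_carrier [simp]:
  "ket n i \<in> carrier_mat n (Suc 0)" "ket_plus \<in> carrier_mat 2 (Suc 0)" "ket_minus \<in> carrier_mat 2 (Suc 0)"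
  "ket_plus_i \<in> carrier_mat 2 (Suc 0)" "ket_minus_i \<in> carrier_mat 2 (Suc 0)"
  by (auto simp: ket_def ket_plus_def ket_minus_def ket_plus_i_def ket_minus_i_def intro!: carrier_matI)

lemma index_ket [simp]: "i < n \<Longrightarrow> ket n k $$ (i, 0) = (if i = k then 1 else 0)"
  by (simp add: ket_def)

lemma dim_ket [simp]: "dim_row (ket n k) = n" "dim_col (ket n k) = 1"
  by (simp_all add: ket_def)

lemma index_qubit_kets [simp]:
  "ket_plus $$ (0, 0) = 1 / of_real (sqrt 2)" "ket_plus $$ (Suc 0, 0) = 1 / of_real (sqrt 2)"
  "ket_minus $$ (0, 0) = 1 / of_real (sqrt 2)" "ket_minus $$ (Suc 0, 0) = - 1 / of_real (sqrt 2)"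
  "ket_plus_i $$ (0, 0) = 1 / of_real (sqrt 2)" "ket_plus_i $$ (Suc 0, 0) = \<i> / of_real (sqrt 2)"
  "ket_minus_i $$ (0, 0) = 1 / of_real (sqrt 2)" "ket_minus_i $$ (Suc 0, 0) = - \<i> / of_real (sqrt 2)"
  by (simp_all add: ket_plus_def ket_minus_def ket_plus_i_def ket_minus_i_def)

lemma of_real_sqrt_2_power_4 [simp]:
  "complex_of_real (sqrt 2) * (complex_of_real (sqrt 2) * (complex_of_real (sqrt 2) * complex_of_real (sqrt 2))) = 4"
  by (simp flip: of_real_mult)

lemma outer_kron_sum_eq_x_mat:
  assumes "u \<in> carrier_mat 2 1" "v \<in> carrier_mat 2 1" "u' \<in> carrier_mat 2 1" "v' \<in> carrier_mat 2 1"
    and "\<And>i j. i < 4 \<Longrightarrow> j < 4 \<Longrightarrow>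
      (u $$ (i div 2, 0) * v $$ (i mod 2, 0)) * cnj (u $$ (j div 2, 0) * v $$ (j mod 2, 0)) +
      (u' $$ (i div 2, 0) * v' $$ (i mod 2, 0)) * cnj (u' $$ (j div 2, 0) * v' $$ (j mod 2, 0)) =
      x_mat p q r s a b $$ (i, j)"
  shows "outer (kron u v) + outer (kron u' v') = x_mat p q r s a b"
proof (rule eq_matI)
  fix i j assume "i < dim_row (x_mat p q r s a b)" "j < dim_col (x_mat p q r s a b)"
  then have ij: "i < 4" "j < 4" by auto
  then show "(outer (kron u v) + outer (kron u' v')) $$ (i, j) = x_mat p q r s a b $$ (i, j)"
    using outer_kron_carrier[OF assms(3,4)] assms(5)[OF ij]
    by (simp add: index_outer_kron_qubits[OF assms(1,2) ij] index_outer_kron_qubits[OF assms(3,4) ij])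
qed (use outer_kron_carrier[OF assms(3,4)] in auto)

lemma Pi_plus_eq: "Pi_plus = x_mat 1 0 0 1 0 0"
  unfolding Pi_plus_def by (rule outer_kron_sum_eq_x_mat) (auto simp: less_4_cases)

lemma Pi_minus_eq: "Pi_minus = x_mat 0 1 1 0 0 0"
  unfolding Pi_minus_def by (rule outer_kron_sum_eq_x_mat) (auto simp: less_4_cases)

text \<open>Half of the identity minus the tensor square of the Pauli matrix X.\<close>

lemma Pi_x_minus_eq: "Pi_x_minus = x_mat (1/2) (1/2) (1/2) (1/2) (- 1/2) (- 1/2)"
  unfolding Pi_x_minus_def by (rule outer_kron_sum_eq_x_mat) (auto simp: less_4_cases mult.assoc)

text \<open>Half of the identity plus the tensor square of Pauli Y. Its inner sign differs from that
  of \<open>Pi_x_minus\<close>, so the two error rates separate the real parts of the two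
  off-diagonal entries.\<close>

lemma Pi_y_minus_eq: "Pi_y_minus = x_mat (1/2) (1/2) (1/2) (1/2) (- 1/2) (1/2)"
  unfolding Pi_y_minus_def by (rule outer_kron_sum_eq_x_mat) (auto simp: less_4_cases mult.assoc)

lemma sigma_x_B_carrier [simp]: "sigma_x_B \<in> carrier_mat 4 4"
  by (rule carrier_matI) (auto simp: sigma_x_B_def kron_def)

lemma index_sigma_x_B:
  "i < 4 \<Longrightarrow> j < 4 \<Longrightarrow> sigma_x_B $$ (i, j) = (if i div 2 = j div 2 \<and> i mod 2 \<noteq> j mod 2 then 1 else 0)"
  by (auto simp: sigma_x_B_def kron_def)

text \<open>Flipping Bob's bit sends 01 to 00 and 10 to 11, and so moves the inner block to the
  outer position.\<close>

lemma sigma_x_B_conj_x_mat: "sigma_x_B * x_mat 0 q r 0 0 b * sigma_x_B = x_mat q 0 0 r b 0"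
proof (rule eq_matI)
  fix i j assume "i < dim_row (x_mat q 0 0 r b 0)" "j < dim_col (x_mat q 0 0 r b 0)"
  then have ij: "i < 4" "j < 4" by auto
  have carr: "sigma_x_B * x_mat 0 q r 0 0 b \<in> carrier_mat 4 4" by simp
  show "(sigma_x_B * x_mat 0 q r 0 0 b * sigma_x_B) $$ (i, j) = x_mat q 0 0 r b 0 $$ (i, j)"
    using ij unfolding index_mult_mat_4[OF carr sigma_x_B_carrier ij] less_4_cases
    by (elim disjE) (simp_all add: index_mult_mat_4[OF sigma_x_B_carrier x_mat_carrier] index_sigma_x_B
        del: index_mult_mat(1))
qed (simp_all add: sigma_x_B_def kron_def)

lemma index_hermitian:
  assumes "mat_adjoint \<rho> = \<rho>" "\<rho> \<in> carrier_mat n n" "i < n" "j < n"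
  shows "\<rho> $$ (j, i) = cnj (\<rho> $$ (i, j))"
  using index_mat_adjoint[of j \<rho> i] assms by simp

text \<open>All projectors of the protocol are in X form, so of an arbitrary \<rho> only the
  diagonal and the entries at \<open>(0, 3)\<close> and \<open>(1, 2)\<close> matter.\<close>

lemma Pi_conj_hermitian:
  assumes \<rho>: "\<rho> \<in> carrier_mat 4 4" "mat_adjoint \<rho> = \<rho>"
    and d: "\<rho> $$ (0, 0) = of_real p" "\<rho> $$ (1, 1) = of_real q" "\<rho> $$ (2, 2) = of_real r" "\<rho> $$ (3, 3) = of_real s"
  shows "Pi_plus * \<rho> * Pi_plus = x_mat p 0 0 s (\<rho> $$ (0, 3)) 0"
    and "Pi_minus * \<rho> * Pi_minus = x_mat 0 q r 0 0 (\<rho> $$ (1, 2))"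
    and "Phi \<rho> = x_mat p q r s (\<rho> $$ (0, 3)) (\<rho> $$ (1, 2))"
    and "mtrace (Pi_plus * \<rho>) = of_real (p + s)"
    and "mtrace (Pi_minus * \<rho>) = of_real (q + r)"
    and "mtrace (Pi_x_minus * \<rho>) = of_real ((p + q + r + s) / 2 - Re (\<rho> $$ (0, 3)) - Re (\<rho> $$ (1, 2)))"
    and "mtrace (Pi_y_minus * \<rho>) = of_real ((p + q + r + s) / 2 - Re (\<rho> $$ (0, 3)) + Re (\<rho> $$ (1, 2)))"
proof -
  have h: "\<rho> $$ (3, 0) = cnj (\<rho> $$ (0, 3))" "\<rho> $$ (2, 1) = cnj (\<rho> $$ (1, 2))"
    by (rule index_hermitian[OF \<rho>(2,1)]; simp)+
  \<comment> \<open>Both parity projectors at once: \<open>x\<close> and \<open>y\<close> indicate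
    which of the two blocks survives.\<close>
  have conj: "(x_mat x y y x 0 0 * \<rho> * x_mat x y y x 0 0) =
      x_mat (x * p) (y * q) (y * r) (x * s) (of_real x * \<rho> $$ (0, 3)) (of_real y * \<rho> $$ (1, 2))"
    if xy: "x = 1 \<and> y = 0 \<or> x = 0 \<and> y = 1" for x y
  proof (rule eq_matI)
    let ?R = "x_mat (x * p) (y * q) (y * r) (x * s) (of_real x * \<rho> $$ (0, 3)) (of_real y * \<rho> $$ (1, 2))"
    fix i j assume "i < dim_row ?R" "j < dim_col ?R"
    then have ij: "i < 4" "j < 4" by auto
    have carr: "x_mat x y y x 0 0 * \<rho> \<in> carrier_mat 4 4" using \<rho>(1) by simp
    show "(x_mat x y y x 0 0 * \<rho> * x_mat x y y x 0 0) $$ (i, j) = ?R $$ (i, j)"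
      using ij xy unfolding index_mult_mat_4[OF carr x_mat_carrier ij] less_4_cases
      by (elim disjE) (simp_all add: index_mult_mat_4[OF x_mat_carrier \<rho>(1)] h[simplified] d[simplified]
          del: index_mult_mat(1))
  qed simp_all
  show P: "Pi_plus * \<rho> * Pi_plus = x_mat p 0 0 s (\<rho> $$ (0, 3)) 0"
    using conj[of 1 0] by (simp add: Pi_plus_eq)
  show M: "Pi_minus * \<rho> * Pi_minus = x_mat 0 q r 0 0 (\<rho> $$ (1, 2))"
    using conj[of 0 1] by (simp add: Pi_minus_eq)
  show "Phi \<rho> = x_mat p q r s (\<rho> $$ (0, 3)) (\<rho> $$ (1, 2))"
    unfolding Phi_def P M by (rule eq_matI) (auto simp: less_4_cases)
  have tr: "mtrace (x_mat p' q' r' s' a b * \<rho>) = of_real (p' * p + q' * q + r' * r + s' * s) +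
      (a * cnj (\<rho> $$ (0, 3)) + cnj a * \<rho> $$ (0, 3)) + (b * cnj (\<rho> $$ (1, 2)) + cnj b * \<rho> $$ (1, 2))"
    for p' q' r' s' a b
    by (simp add: mtrace_def sum_lessThan_4 index_mult_mat_4[OF x_mat_carrier \<rho>(1)] h[simplified] d[simplified]
        del: index_mult_mat(1))
  show "mtrace (Pi_plus * \<rho>) = of_real (p + s)" "mtrace (Pi_minus * \<rho>) = of_real (q + r)"
    "mtrace (Pi_x_minus * \<rho>) = of_real ((p + q + r + s) / 2 - Re (\<rho> $$ (0, 3)) - Re (\<rho> $$ (1, 2)))"
    "mtrace (Pi_y_minus * \<rho>) = of_real ((p + q + r + s) / 2 - Re (\<rho> $$ (0, 3)) + Re (\<rho> $$ (1, 2)))"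
    unfolding Pi_plus_eq Pi_minus_eq Pi_x_minus_eq Pi_y_minus_eq tr
    by (simp_all add: complex_eq_iff field_simps)
qed

text \<open>Vectors supported on the coordinates \<open>i\<close> and \<open>j\<close> reduce
  positivity to that of a single block.\<close>

lemma psd_offdiag_bound:
  assumes \<rho>: "\<rho> \<in> carrier_mat 4 4" "mat_adjoint \<rho> = \<rho>" "\<And>v. v \<in> carrier_vec 4 \<Longrightarrow> 0 \<le> Re ((\<rho> *\<^sub>v v) \<bullet>c v)"
    and ij: "i < 4" "j < 4" "i \<noteq> j"
    and d: "\<rho> $$ (i, i) = of_real x" "\<rho> $$ (j, j) = of_real y" "0 \<le> x" "0 \<le> y"
  shows "(cmod (\<rho> $$ (i, j)))\<^sup>2 \<le> x * y"
proof (rule block_form_bound[OF d(3,4)])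
  fix v w :: complex
  define u where "u = vec 4 (\<lambda>k. if k = i then v else if k = j then w else 0)"
  have u: "u \<in> carrier_vec 4" by (simp add: u_def)
  have ui: "u $ k = (if k = i then v else 0) + (if k = j then w else 0)" if "k < 4" for k
    using that ij(3) by (auto simp: u_def)
  have inner: "(\<Sum>l<4. \<rho> $$ (k, l) * u $ l) = \<rho> $$ (k, i) * v + \<rho> $$ (k, j) * w" for k
  proof -
    have "(\<Sum>l<4. \<rho> $$ (k, l) * u $ l) =
        (\<Sum>l<4. (if l = i then \<rho> $$ (k, i) * v else 0) + (if l = j then \<rho> $$ (k, j) * w else 0))"
      by (rule sum.cong) (use ij(3) in \<open>auto simp: ui\<close>)
    then show ?thesis using ij(1,2) by (simp add: sum.distrib)
  qed
  have "(\<rho> *\<^sub>v u) \<bullet>c u = (\<Sum>k<4. (\<rho> $$ (k, i) * v + \<rho> $$ (k, j) * w) * cnj (u $ k))"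
    unfolding cscalar_prod_4[OF \<rho>(1) u] inner ..
  also have "\<dots> = (\<Sum>k<4. (if k = i then (\<rho> $$ (i, i) * v + \<rho> $$ (i, j) * w) * cnj v else 0) +
      (if k = j then (\<rho> $$ (j, i) * v + \<rho> $$ (j, j) * w) * cnj w else 0))"
    by (rule sum.cong) (auto simp: ui ij(3))
  also have "\<dots> = (\<rho> $$ (i, i) * v + \<rho> $$ (i, j) * w) * cnj v + (\<rho> $$ (j, i) * v + \<rho> $$ (j, j) * w) * cnj w"
    using ij by (simp add: sum.distrib)
  finally have "Re ((\<rho> *\<^sub>v u) \<bullet>c u) = Re ((of_real x * v + \<rho> $$ (i, j) * w) * cnj v +
      (cnj (\<rho> $$ (i, j)) * v + of_real y * w) * cnj w)"
    using index_hermitian[OF \<rho>(2,1) ij(1,2)] by (simp add: d(1,2))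
  also have "\<dots> = x * (cmod v)\<^sup>2 + y * (cmod w)\<^sup>2 + 2 * Re (\<rho> $$ (i, j) * w * cnj v)"
    unfolding cmod_power2 by (simp add: power2_eq_square algebra_simps)
  finally show "0 \<le> x * (cmod v)\<^sup>2 + y * (cmod w)\<^sup>2 + 2 * Re (\<rho> $$ (i, j) * w * cnj v)"
    using \<rho>(3)[OF u] by simp
qed

lemma tau_eq_x_mat:
  "tau m00 m11 m22 m33 ex ey = x_mat m00 m11 m22 m33 (of_real ((1 - ex - ey) / 2)) (of_real ((ey - ex) / 2))"
  (is "?T = ?X")
proof (rule eq_matI)
  fix i j assume "i < dim_row ?X" "j < dim_col ?X"
  then have "i < 4" "j < 4" by auto
  then show "?T $$ (i, j) = ?X $$ (i, j)"
    unfolding less_4_cases by (elim disjE) (simp_all add: tau_def mat_of_rows_list_def)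
qed (simp_all add: tau_def mat_of_rows_list_def)

lemma min_over_eqI:
  fixes f :: "'a \<Rightarrow> real"
  assumes "x \<in> S" "\<And>y. y \<in> S \<Longrightarrow> f x \<le> f y"
  shows "attains_min f S" "min_over f S = f x"
  using assms unfolding attains_min_def min_over_def by (auto intro!: Least_equality)

section \<open>The states compatible with parameter estimation\<close>

context
  fixes m00 m11 m22 m33 ex ey :: real
  assumes m_nonneg: "0 \<le> m00" "0 \<le> m11" "0 \<le> m22" "0 \<le> m33"
    and m_sum: "m00 + m11 + m22 + m33 = 1"
begin

lemma six_state_setD:
  assumes "\<rho> \<in> six_state_set m00 m11 m22 m33 ex ey"
  defines "a \<equiv> \<rho> $$ (0, 3)" and "b \<equiv> \<rho> $$ (1, 2)"
  shows "coherence (Phi \<rho>) = block_coherence m00 m33 (cmod a) + block_coherence m11 m22 (cmod b)"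
    and "sifted_randomness (m11 + m22) \<rho> = coherence (Phi \<rho>)"
    and "Re a = (1 - ex - ey) / 2" and "Re b = (ey - ex) / 2"
    and "(cmod a)\<^sup>2 \<le> m00 * m33" and "(cmod b)\<^sup>2 \<le> m11 * m22"
proof -
  have \<rho>: "\<rho> \<in> carrier_mat 4 4" "mat_adjoint \<rho> = \<rho>" "\<And>v. v \<in> carrier_vec 4 \<Longrightarrow> 0 \<le> Re ((\<rho> *\<^sub>v v) \<bullet>c v)"
    and d: "\<rho> $$ (0, 0) = of_real m00" "\<rho> $$ (1, 1) = of_real m11" "\<rho> $$ (2, 2) = of_real m22" "\<rho> $$ (3, 3) = of_real m33"
    and ex: "mtrace (Pi_x_minus * \<rho>) = of_real ex" and ey: "mtrace (Pi_y_minus * \<rho>) = of_real ey"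
    using assms(1) by (auto simp: six_state_set_def density_operator_def)
  note P = Pi_conj_hermitian[OF \<rho>(1,2) d, folded a_def b_def]
  show coh: "coherence (Phi \<rho>) = block_coherence m00 m33 (cmod a) + block_coherence m11 m22 (cmod b)"
    unfolding P(3) by (rule coherence_x_mat)
  show a2: "(cmod a)\<^sup>2 \<le> m00 * m33" and b2: "(cmod b)\<^sup>2 \<le> m11 * m22"
    unfolding a_def b_def using psd_offdiag_bound[OF \<rho>, of 0 3] psd_offdiag_bound[OF \<rho>, of 1 2] d m_nonneg
    by auto
  have "ex = 1 / 2 - Re a - Re b" "ey = 1 / 2 - Re a + Re b"
    using ex ey unfolding P(6,7) m_sum of_real_eq_iff by simp_all
  then show "Re a = (1 - ex - ey) / 2" and "Re b = (ey - ex) / 2" by simp_all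
  \<comment> \<open>By homogeneity the weight \<open>w\<close> of a conditional state undoes its
    normalisation.\<close>
  have scale: "w * intrinsic_randomness (x_mat (x / w) 0 0 (y / w) (c / of_real w) 0) = block_coherence x y (cmod c)"
    if "0 < w" "0 \<le> x" "0 \<le> y" "(cmod c)\<^sup>2 \<le> x * y" for w x y c
  proof -
    have le: "(cmod (c / of_real w))\<^sup>2 \<le> (x / w) * (y / w)"
      using that by (simp add: norm_divide power_divide power2_eq_square divide_right_mono)
    have "intrinsic_randomness (x_mat (x / w) 0 0 (y / w) (c / of_real w) 0) =
        block_coherence (x / w) (y / w) (cmod (c / of_real w))"
      using that le by (subst intrinsic_randomness_x_mat) auto
    then show ?thesis
      using block_coherence_mult[of w "x / w" "y / w" "cmod (c / of_real w)"] that le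
      by (simp add: norm_divide)
  qed
  have smult: "(1 / complex_of_real w) \<cdot>\<^sub>m x_mat p q r s c c' =
      x_mat (p / w) (q / w) (r / w) (s / w) (c / of_real w) (c' / of_real w)" for w p q r s c c'
    by (rule eq_matI) (auto simp: less_4_cases)
  have plus: "(if 1 - (m11 + m22) = 0 then 0
      else (1 - (m11 + m22)) * intrinsic_randomness (conditional_state Pi_plus \<rho>)) = block_coherence m00 m33 (cmod a)"
  proof (cases "m00 + m33 = 0")
    \<comment> \<open>An omitted term of weight zero: its diagonal entries vanish, positivity forces
      \<open>a = 0\<close>, and the coherence of the block is zero too.\<close>
    case True
    then have "m00 = 0" "m33 = 0" using m_nonneg by auto
    moreover from this have "a = 0" using a2 by simp
    ultimately show ?thesis using m_sum by simp
  next
    case False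
    then have "0 < m00 + m33" using m_nonneg by simp
    moreover have "1 - (m11 + m22) = m00 + m33" using m_sum by simp
    ultimately show ?thesis
      unfolding conditional_state_def P(1,4) smult using scale[of "m00 + m33" m00 m33 a] m_nonneg a2 by simp
  qed
  have minus: "(if m11 + m22 = 0 then 0
      else (m11 + m22) * intrinsic_randomness (sigma_x_B * conditional_state Pi_minus \<rho> * sigma_x_B)) =
      block_coherence m11 m22 (cmod b)"
  proof (cases "m11 + m22 = 0")
    case True
    then have "m11 = 0" "m22 = 0" using m_nonneg by auto
    moreover from this have "b = 0" using b2 by simp
    ultimately show ?thesis by simp
  next
    case False
    then have "0 < m11 + m22" using m_nonneg by simp
    \<comment> \<open>The bit flip brings the inner block to the outer position, for which
      \<open>scale\<close> is stated.\<close>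
    then show ?thesis
      unfolding conditional_state_def P(2,5) smult
      using scale[of "m11 + m22" m11 m22 b] m_nonneg b2 by (simp add: sigma_x_B_conj_x_mat)
  qed
  show "sifted_randomness (m11 + m22) \<rho> = coherence (Phi \<rho>)"
    unfolding sifted_randomness_def plus minus coh ..
qed

text \<open>Positivity of \<open>tau\<close> comes from any member of the set: the entries of
  \<open>tau\<close> are the real parts of that member's entries, so their moduli obey the same
  bounds.\<close>

lemma tau_in_six_state_set:
  assumes "six_state_set m00 m11 m22 m33 ex ey \<noteq> {}"
  shows "tau m00 m11 m22 m33 ex ey \<in> six_state_set m00 m11 m22 m33 ex ey"
proof -
  define a b where "a = (1 - ex - ey) / 2" and "b = (ey - ex) / 2"
  obtain \<rho> where \<rho>: "\<rho> \<in> six_state_set m00 m11 m22 m33 ex ey" using assms by blast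
  have "\<bar>a\<bar> \<le> cmod (\<rho> $$ (0, 3))" "\<bar>b\<bar> \<le> cmod (\<rho> $$ (1, 2))"
    using six_state_setD(3,4)[OF \<rho>] abs_Re_le_cmod unfolding a_def b_def by metis+
  then have ab: "a\<^sup>2 \<le> m00 * m33" "b\<^sup>2 \<le> m11 * m22"
    using six_state_setD(5,6)[OF \<rho>] power_mono[of "\<bar>a\<bar>" _ 2] power_mono[of "\<bar>b\<bar>" _ 2] by fastforce+
  have t: "tau m00 m11 m22 m33 ex ey = x_mat m00 m11 m22 m33 (of_real a) (of_real b)"
    unfolding tau_eq_x_mat a_def b_def ..
  note P = Pi_conj_hermitian[OF x_mat_carrier mat_adjoint_x_mat index_x_mat(1,7,17,23),
      of m00 m11 m22 m33 "of_real a" "of_real b"]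
  show ?thesis
    unfolding t six_state_set_def density_operator_def mem_Collect_eq mat_adjoint_x_mat mtrace_x_mat P(6,7) index_x_mat
  proof (intro conjI ballI)
    show "0 \<le> Re ((x_mat m00 m11 m22 m33 (of_real a) (of_real b) *\<^sub>v v) \<bullet>c v)" if "v \<in> carrier_vec 4" for v
      using ab that by (intro x_mat_form_nonneg[OF m_nonneg]) simp_all
  qed (use m_sum in \<open>simp_all add: a_def b_def field_simps\<close>)
qed

end

theorem theorem3:
  fixes m00 m11 m22 m33 ex ey ez eb :: real and S :: "complex mat set"
  assumes "m00 \<ge> 0" and "m11 \<ge> 0" and "m22 \<ge> 0" and "m33 \<ge> 0"
    and "m00 + m11 + m22 + m33 = 1"
    and "ez = eb" and "eb = m11 + m22"
    and "S = six_state_set m00 m11 m22 m33 ex ey"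
    and "S \<noteq> {}"
  shows "attains_min (sifted_randomness eb) S
    \<and> attains_min (\<lambda>\<rho>. coherence (Phi \<rho>)) S
    \<and> key_rate eb S = min_over (\<lambda>\<rho>. coherence (Phi \<rho>)) S - binary_entropy eb
    \<and> min_over (\<lambda>\<rho>. coherence (Phi \<rho>)) S - binary_entropy eb
        = K_six_opt m00 m11 m22 m33 ex ey ez"
proof -
  let ?\<tau> = "tau m00 m11 m22 m33 ex ey"
  note D = six_state_setD[OF assms(1-5)]
  have \<tau>: "?\<tau> \<in> S" using tau_in_six_state_set[OF assms(1-5)] assms(8,9) by simp
  \<comment> \<open>\<open>tau\<close> is already in X form, so \<open>Phi\<close> removes
    nothing.\<close>
  have coh\<tau>: "coherence (Phi ?\<tau>) = coherence ?\<tau>"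
    using D(1)[of ?\<tau>] \<tau> assms(8) by (simp add: tau_eq_x_mat coherence_x_mat)
  have min: "coherence (Phi ?\<tau>) \<le> coherence (Phi \<rho>)" if "\<rho> \<in> S" for \<rho>
  proof -
    have \<rho>: "\<rho> \<in> six_state_set m00 m11 m22 m33 ex ey" using that assms(8) by simp
    have "coherence (Phi ?\<tau>) = block_coherence m00 m33 \<bar>(1 - ex - ey) / 2\<bar> + block_coherence m11 m22 \<bar>(ey - ex) / 2\<bar>"
      unfolding coh\<tau> by (simp add: tau_eq_x_mat coherence_x_mat del: of_real_divide of_real_diff)
    \<comment> \<open>The absolute values on the left are those of the real parts, which are the
      same throughout \<open>S\<close> and bound the moduli from below.\<close>
    also have "\<dots> \<le> block_coherence m00 m33 (cmod (\<rho> $$ (0, 3))) + block_coherence m11 m22 (cmod (\<rho> $$ (1, 2)))"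
      using D(3-6)[OF \<rho>] abs_Re_le_cmod[of "\<rho> $$ (0, 3)"] abs_Re_le_cmod[of "\<rho> $$ (1, 2)"] assms(1-4)
      by (intro add_mono block_coherence_mono) simp_all
    finally show ?thesis unfolding D(1)[OF \<rho>] .
  qed
  have sift: "sifted_randomness eb \<rho> = coherence (Phi \<rho>)" if "\<rho> \<in> S" for \<rho>
    using D(2) that assms(7,8) by simp
  show ?thesis
    using min_over_eqI[of ?\<tau> S "\<lambda>\<rho>. coherence (Phi \<rho>)"] min_over_eqI[of ?\<tau> S "sifted_randomness eb"]
      \<tau> min sift coh\<tau> assms(6)
    by (simp add: key_rate_def K_six_opt_def)
qed

end
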